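(* Let $A$ be a finite-dimensional real alternative algebra with unity and a fixed antiinvolution $x\mapsto x^c$, with $\mathbb{S}_A\neq\emptyset$. Let $p(x)=\sum_{j=0}^m x^j a_j$ be a polynomial of degree $m>0$ with coefficients in $A$, regarded as a slice regular function on $Q_A$. Assume that $p$ is admissible (for example, this is true in the case in which the real vector subspace $\langle a_0,\ldots,a_m\rangle$ of $A$ is contained in $N_A$). Then $V(p)=\{y\in Q_A \mid p(y)=0\}$ is non-empty. More precisely, there are distinct "spheres" $\mathbb{S}_{x_1},\ldots,\mathbb{S}_{x_t}$ (with $x_k\in Q_A$) such that \[V(p)\subseteq\bigcup_{k=1}^t \mathbb{S}_{x_k}=V(N(p)),\qquad V(p)\cap\mathbb{S}_{x_j}\neq\emptyset\ \text{ for every } j,\] and, for any choice of zeros $y_1\in\mathbb{S}_{x_1},\ldots,y_t\in\mathbb{S}_{x_t}$ of $p$, the following equality holds: \[\sum_{k=1}^t m_p(y_k)=m.\]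
   Context: Setting. $A$ is a finite-dimensional real alternative algebra with unity, of real dimension $d>1$ (alternative: the associator $(x,y,z)=(xy)z-x(yz)$ is alternating); $\mathbb{R}$ is identified with $\mathbb{R}\cdot 1\subseteq A$. An antiinvolution $x\mapsto x^c$ is fixed: a linear map with $(x^c)^c=x$, $(xy)^c=y^cx^c$, and $x^c=x$ for $x\in\mathbb{R}$. Put $t(x)=x+x^c$, $n(x)=xx^c$ (elements of $A$, not assumed real). Normal cone: $N_A=\{0\}\cup\{x\in A \mid n(x)=n(x^c)\text{ is a real nonzero number}\}$. Quadratic cone: $Q_A=\mathbb{R}\cup\{x\in A\mid t(x)\in\mathbb{R},\ n(x)\in\mathbb{R},\ 4n(x)>t(x)^2\}$. $\mathbb{S}_A=\{J\in Q_A\mid J^2=-1\}$, assumed non-empty. For $J\in\mathbb{S}_A$, $\mathbb{C}_J=\langle 1,J\rangle\simeq\mathbb{C}$; one has $Q_A=\bigcup_{J\in\mathbb{S}_A}\mathbb{C}_J$. For $x=\alpha+\beta J\in Q_A$ ($\alpha,\beta\in\mathbb{R}$, $J\in\mathbb{S}_A$), $\mathbb{S}_x=\{\alpha+\beta I\mid I\in\mathbb{S}_A\}$. Slice functions. $A_{\mathbb{C}}=A\otimes_{\mathbb{R}}\mathbb{C}=\{x+iy\mid x,y\in A\}$ with product $(x+iy)(x'+iy')=xx'-yy'+i(xy'+yx')$, conjugation $\overline{x+iy}=x-iy$, and $(x+iy)^c=x^c+iy^c$. For an open conjugation-invariant $D\subseteq\mathbb{C}$, a stem function is $F=F_1+iF_2:D\to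 A_{\mathbb{C}}$ ($F_1,F_2$ $A$-valued) with $F(\bar z)=\overline{F(z)}$. Let $\Omega_D=\{\alpha+\beta J\mid \alpha,\beta\in\mathbb{R},\ \alpha+i\beta\in D,\ J\in\mathbb{S}_A\}$. The slice function $f=\mathcal{I}(F):\Omega_D\to A$ is $f(\alpha+\beta J)=F_1(\alpha+i\beta)+JF_2(\alpha+i\beta)$. It is slice regular if $F$ is $C^1$ and holomorphic (for left multiplication by $i$). It is admissible if the real span $\langle F_1(z),F_2(z)\rangle\subseteq N_A$ for every $z\in D$. Product: $\mathcal{I}(F)\cdot\mathcal{I}(G)=\mathcal{I}(FG)$; when $F_1,F_2$ are real-valued (then $f$ is called real) this is the pointwise product. $f^c=\mathcal{I}(F^c)$, $F^c(z)=F(z)^c$, and $N(f)=f\cdot f^c=\mathcal{I}(FF^c)$ is the normal function. $V(f)$ is the zero set of $f$. The polynomial $p(x)=\sum_j x^ja_j$ is the slice regular function on $Q_A=\Omega_{\mathbb{C}}$ induced by $P(z)=\sum_j z^ja_j$; $N(p)(x)=\sum_n x^n\big(\sum_{j+k=n}a_ja_k^c\big)$. Multiplicity. For $y\in Q_A$, $\Delta_y(x)=x^2-x\,t(y)+n(y)$ (a real slice regular function on $Q_A$). For an admissible slice regular $f$ on $\Omega_D$ with $N(f)\not\equiv0$ and $y\in V(f)$, the multiplicity $m_f(y)$ is the non-negative integer $s$ such that $\Delta_y^s\mid N(f)$ and $\Delta_y^{s+1}\nmid N(f)$, where $\Delta_y^s\mid N(f)$ means $N(f)=\Delta_y^s\,g$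 for some slice regular $g$ on $\Omega_D$.
   Formalization: The formal theorem additionally assumes that the leading coefficient a_m lies in N_A; without it the claim fails, e.g. for x^2 E12 + x + (E21 − E12) over real 2×2 matrices with the adjugate, which is admissible but has N(p) = 1 and no zeros. *)

theory Defs
  imports "HOL-Analysis.Analysis"
begin

(* The product is not associative, so the algebra is a record of operations on a
   finite-dimensional real vector space. The class euclidean_space only supplies finite
   dimension and the (unique) vector space topology; its inner product plays no role. *)
record 'a star_algebra =
  amult :: "'a \<Rightarrow> 'a \<Rightarrow> 'a"  (infixl "\<odot>\<index>" 70)
  aone :: 'a  ("\<one>\<index>")
  aconj :: "'a \<Rightarrow> 'a"

definition associator :: "'a::euclidean_space star_algebra \<Rightarrow> 'a \<Rightarrow> 'a \<Rightarrow> 'a \<Rightarrow> 'a" where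
  "associator A x y z = (x \<odot>\<^bsub>A\<^esub> y) \<odot>\<^bsub>A\<^esub> z - x \<odot>\<^bsub>A\<^esub> (y \<odot>\<^bsub>A\<^esub> z)"

definition areal :: "'a::euclidean_space star_algebra \<Rightarrow> real \<Rightarrow> 'a" where
  "areal A r = r *\<^sub>R \<one>\<^bsub>A\<^esub>"

locale alternative_star_algebra =
  fixes A :: "'a::euclidean_space star_algebra" (structure)
  assumes dim_gt_1: "DIM('a) > 1"
    and bilinear_mult: "bilinear (amult A)"
    and one_left: "\<one> \<odot> x = x"
    and one_right: "x \<odot> \<one> = x"
    and alternating: "associator A x x y = 0" "associator A x y x = 0" "associator A y x x = 0"
    and linear_conj: "linear (aconj A)"
    and conj_conj: "aconj A (aconj A x) = x"
    and conj_mult: "aconj A (x \<odot> y) = aconj A y \<odot> aconj A x"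
    and conj_real: "aconj A (areal A r) = areal A r"

primrec apow :: "'a::euclidean_space star_algebra \<Rightarrow> 'a \<Rightarrow> nat \<Rightarrow> 'a" where
  "apow A x 0 = \<one>\<^bsub>A\<^esub>"
| "apow A x (Suc n) = x \<odot>\<^bsub>A\<^esub> apow A x n"

definition atrace :: "'a::euclidean_space star_algebra \<Rightarrow> 'a \<Rightarrow> 'a" where
  "atrace A x = x + aconj A x"

definition anorm :: "'a::euclidean_space star_algebra \<Rightarrow> 'a \<Rightarrow> 'a" where
  "anorm A x = x \<odot>\<^bsub>A\<^esub> aconj A x"

definition normal_cone :: "'a::euclidean_space star_algebra \<Rightarrow> 'a set" where
  "normal_cone A =
    {0} \<union> {x. \<exists>r. r \<noteq> 0 \<and> anorm A x = areal A r \<and> anorm A (aconj A x) = areal A r}"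

definition quadratic_cone :: "'a::euclidean_space star_algebra \<Rightarrow> 'a set" where
  "quadratic_cone A =
    range (areal A) \<union> {x. \<exists>t n. atrace A x = areal A t \<and> anorm A x = areal A n \<and> 4 * n > t\<^sup>2}"

definition imaginary_units :: "'a::euclidean_space star_algebra \<Rightarrow> 'a set" where
  "imaginary_units A = {J \<in> quadratic_cone A. J \<odot>\<^bsub>A\<^esub> J = - \<one>\<^bsub>A\<^esub>}"

(* The decomposition x = \<alpha> + \<beta> J is unique up to (\<beta>, J) \<mapsto> (- \<beta>, - J) if x is not real, and has
   \<beta> = 0 with J arbitrary if x is real; neither choice affects the set of \<alpha> + \<beta> I. *)
definition sphere_of :: "'a::euclidean_space star_algebra \<Rightarrow> 'a \<Rightarrow> 'a set" where
  "sphere_of A x =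
    {areal A \<alpha> + \<beta> *\<^sub>R I |\<alpha> \<beta> J I.
      J \<in> imaginary_units A \<and> I \<in> imaginary_units A \<and> x = areal A \<alpha> + \<beta> *\<^sub>R J}"

(* The element x + i y of the complexified algebra is the pair (x, y), so a stem function
   F1 + i F2 has values (F1 z, F2 z). A slice function is represented by its stem function. *)
definition stem_function :: "complex set \<Rightarrow> (complex \<Rightarrow> 'a::euclidean_space \<times> 'a) \<Rightarrow> bool" where
  "stem_function D F \<longleftrightarrow>
    open D \<and> cnj ` D \<subseteq> D \<and> (\<forall>z\<in>D. F (cnj z) = (fst (F z), - snd (F z)))"

definition slice_domain :: "'a::euclidean_space star_algebra \<Rightarrow> complex set \<Rightarrow> 'a set" where
  "slice_domain A D =
    {areal A \<alpha> + \<beta> *\<^sub>R J |\<alpha> \<beta> J. Complex \<alpha> \<beta> \<in> D \<and> J \<in> imaginary_units A}"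

(* The value does not depend on the decomposition of x: see slice_eq below. *)
definition slice ::
    "'a::euclidean_space star_algebra \<Rightarrow> (complex \<Rightarrow> 'a \<times> 'a) \<Rightarrow> 'a \<Rightarrow> 'a" where
  "slice A F x =
    (THE v. \<exists>\<alpha> \<beta> J. J \<in> imaginary_units A \<and> x = areal A \<alpha> + \<beta> *\<^sub>R J \<and>
       v = fst (F (Complex \<alpha> \<beta>)) + J \<odot>\<^bsub>A\<^esub> snd (F (Complex \<alpha> \<beta>)))"

(* C^1 with complex linear derivative, where i (x, y) = (- y, x). *)
definition slice_regular :: "complex set \<Rightarrow> (complex \<Rightarrow> 'a::euclidean_space \<times> 'a) \<Rightarrow> bool" where
  "slice_regular D F \<longleftrightarrow> stem_function D F \<and>
    (\<exists>F'. continuous_on D F' \<and>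
      (\<forall>z\<in>D. (F has_derivative blinfun_apply (F' z)) (at z) \<and>
        (\<forall>w. blinfun_apply (F' z) (\<i> * w) =
          (- snd (blinfun_apply (F' z) w), fst (blinfun_apply (F' z) w)))))"

definition admissible ::
    "'a::euclidean_space star_algebra \<Rightarrow> complex set \<Rightarrow> (complex \<Rightarrow> 'a \<times> 'a) \<Rightarrow> bool" where
  "admissible A D F \<longleftrightarrow> (\<forall>z\<in>D. span {fst (F z), snd (F z)} \<subseteq> normal_cone A)"

definition stem_mult ::
    "'a::euclidean_space star_algebra \<Rightarrow> (complex \<Rightarrow> 'a \<times> 'a) \<Rightarrow> (complex \<Rightarrow> 'a \<times> 'a)
      \<Rightarrow> (complex \<Rightarrow> 'a \<times> 'a)" where
  "stem_mult A F G =
    (\<lambda>z. (fst (F z) \<odot>\<^bsub>A\<^esub> fst (G z) - snd (F z) \<odot>\<^bsub>A\<^esub> snd (G z),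
          fst (F z) \<odot>\<^bsub>A\<^esub> snd (G z) + snd (F z) \<odot>\<^bsub>A\<^esub> fst (G z)))"

primrec stem_pow ::
    "'a::euclidean_space star_algebra \<Rightarrow> (complex \<Rightarrow> 'a \<times> 'a) \<Rightarrow> nat \<Rightarrow> (complex \<Rightarrow> 'a \<times> 'a)" where
  "stem_pow A F 0 = (\<lambda>z. (\<one>\<^bsub>A\<^esub>, 0))"
| "stem_pow A F (Suc n) = stem_mult A F (stem_pow A F n)"

definition stem_conj ::
    "'a::euclidean_space star_algebra \<Rightarrow> (complex \<Rightarrow> 'a \<times> 'a) \<Rightarrow> (complex \<Rightarrow> 'a \<times> 'a)" where
  "stem_conj A F = (\<lambda>z. (aconj A (fst (F z)), aconj A (snd (F z))))"

definition normal_stem ::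
    "'a::euclidean_space star_algebra \<Rightarrow> (complex \<Rightarrow> 'a \<times> 'a) \<Rightarrow> (complex \<Rightarrow> 'a \<times> 'a)" where
  "normal_stem A F = stem_mult A F (stem_conj A F)"

(* The polynomial function x \<mapsto> \<Sum>j x^j a_j, and the stem function z \<mapsto> \<Sum>j z^j a_j inducing it
   (see slice_poly_stem below). *)
definition poly_fun :: "'a::euclidean_space star_algebra \<Rightarrow> (nat \<Rightarrow> 'a) \<Rightarrow> nat \<Rightarrow> 'a \<Rightarrow> 'a" where
  "poly_fun A a m x = (\<Sum>j\<le>m. apow A x j \<odot>\<^bsub>A\<^esub> a j)"

definition poly_stem :: "(nat \<Rightarrow> 'a::euclidean_space) \<Rightarrow> nat \<Rightarrow> complex \<Rightarrow> 'a \<times> 'a" where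
  "poly_stem a m z = (\<Sum>j\<le>m. Re (z ^ j) *\<^sub>R a j, \<Sum>j\<le>m. Im (z ^ j) *\<^sub>R a j)"

(* Admissibility of poly_stem a m constrains F1 and F2 at every finite z, but not the leading
   coefficient, which is only a limit of values in the normal cone: in the algebra of real
   2x2 matrices with the adjugate as antiinvolution (so n = det), p(x) = x^2 E12 + x + (E21 - E12)
   has det (u F1(z) + v F2(z)) = u^2 + Im(z)^2 (u^2 + v^2), hence is admissible, but N(p) = 1 and
   p has no zeros. Its leading coefficient E12 is nilpotent, so not in the normal cone. Zeros
   can be counted by the degree m only if N(p) has degree 2 m, that is, if n(a m) is nonzero;
   for this one needs a m \<in> normal_cone A, which holds in particular if the span of the
   coefficients is contained in the normal cone. *)

(* \<Delta>_y(x) = x^2 - x t(y) + n(y) *)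
definition delta_stem :: "'a::euclidean_space star_algebra \<Rightarrow> 'a \<Rightarrow> complex \<Rightarrow> 'a \<times> 'a" where
  "delta_stem A y = poly_stem (\<lambda>j. [anorm A y, - atrace A y, \<one>\<^bsub>A\<^esub>] ! j) 2"

definition zero_set :: "'a::euclidean_space set \<Rightarrow> ('a \<Rightarrow> 'a) \<Rightarrow> 'a set" where
  "zero_set S f = {x \<in> S. f x = 0}"

definition slice_dvd ::
    "'a::euclidean_space star_algebra \<Rightarrow> complex set \<Rightarrow> (complex \<Rightarrow> 'a \<times> 'a)
      \<Rightarrow> (complex \<Rightarrow> 'a \<times> 'a) \<Rightarrow> bool" where
  "slice_dvd A D F H \<longleftrightarrow>
    (\<exists>G. slice_regular D G \<and>
      (\<forall>x \<in> slice_domain A D. slice A H x = slice A (stem_mult A F G) x))"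

definition zero_multiplicity ::
    "'a::euclidean_space star_algebra \<Rightarrow> complex set \<Rightarrow> (complex \<Rightarrow> 'a \<times> 'a) \<Rightarrow> 'a \<Rightarrow> nat" where
  "zero_multiplicity A D F y =
    (THE s. slice_dvd A D (stem_pow A (delta_stem A y) s) (normal_stem A F) \<and>
          \<not> slice_dvd A D (stem_pow A (delta_stem A y) (Suc s)) (normal_stem A F))"

lemma admissible_poly_stemI:
  assumes "span (a ` {..m}) \<subseteq> normal_cone A"
  shows "admissible A UNIV (poly_stem a m)"
proof -
  have "{fst (poly_stem a m z), snd (poly_stem a m z)} \<subseteq> span (a ` {..m})" for z
    unfolding poly_stem_def by (auto intro!: span_sum span_scale intro: span_base)
  then have "span {fst (poly_stem a m z), snd (poly_stem a m z)} \<subseteq> span (a ` {..m})" for z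
    by (simp add: span_minimal)
  then show ?thesis
    using assms unfolding admissible_def by blast
qed

context alternative_star_algebra
begin

lemmas mult_simps =
  bilinear_ladd[OF bilinear_mult] bilinear_radd[OF bilinear_mult]
  bilinear_lsub[OF bilinear_mult] bilinear_rsub[OF bilinear_mult]
  bilinear_lmul[OF bilinear_mult] bilinear_rmul[OF bilinear_mult]
  bilinear_lneg[OF bilinear_mult] bilinear_rneg[OF bilinear_mult]
  bilinear_lzero[OF bilinear_mult] bilinear_rzero[OF bilinear_mult]
  one_left one_right

lemma one_nonzero: "\<one> \<noteq> 0"
proof
  assume "\<one> = 0"
  then have "x = 0" for x :: 'a
    using one_left[of x] by (simp add: mult_simps)
  then show False
    using nonempty_Basis nonzero_Basis by blast
qed

lemma conj_imaginary_unit: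
  assumes "J \<in> imaginary_units A"
  shows "aconj A J = - J"
proof -
  have JJ: "J \<odot> J = - \<one>" and JQ: "J \<in> quadratic_cone A"
    using assms by (auto simp: imaginary_units_def)
  have not_real: "J \<noteq> r *\<^sub>R \<one>" for r
  proof
    assume "J = r *\<^sub>R \<one>"
    then have "(r * r + 1) *\<^sub>R \<one> = 0"
      using JJ by (simp add: mult_simps scaleR_left_distrib)
    moreover have "r * r + 1 \<noteq> 0"
      by (smt (verit) zero_le_square)
    ultimately show False
      using one_nonzero by simp
  qed
  then obtain t n where tn: "J + aconj A J = t *\<^sub>R \<one>" "J \<odot> aconj A J = n *\<^sub>R \<one>"
    using JQ by (auto simp: quadratic_cone_def atrace_def anorm_def areal_def)
  have c: "aconj A J = t *\<^sub>R \<one> - J"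
    using tn(1) by (simp add: algebra_simps)
  have "t *\<^sub>R J = (n - 1) *\<^sub>R \<one>"
    using tn(2) JJ by (simp add: c mult_simps algebra_simps)
  then have "t \<noteq> 0 \<Longrightarrow> J = ((n - 1) / t) *\<^sub>R \<one>"
    by (metis divide_inverse_commute scaleR_scaleR scaleR_one left_inverse)
  then have "t = 0"
    using not_real by blast
  then show ?thesis
    by (simp add: c)
qed

lemma decomposition_cases:
  assumes "J \<in> imaginary_units A" "J' \<in> imaginary_units A"
    and eq: "areal A \<alpha> + \<beta> *\<^sub>R J = areal A \<alpha>' + \<beta>' *\<^sub>R J'"
  obtains "\<alpha>' = \<alpha>" "\<beta> = 0" "\<beta>' = 0"
    | "\<alpha>' = \<alpha>" "\<beta>' = \<beta>" "J' = J"
    | "\<alpha>' = \<alpha>" "\<beta>' = - \<beta>" "J' = - J"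
proof -
  have tr: "atrace A (areal A u + v *\<^sub>R I) = (2 * u) *\<^sub>R \<one>" if "I \<in> imaginary_units A" for u v I
    using conj_imaginary_unit[OF that]
    by (simp add: atrace_def linear_add[OF linear_conj] conj_real linear_scale[OF linear_conj])
       (simp add: areal_def flip: scaleR_left_distrib)
  have \<alpha>: "\<alpha>' = \<alpha>"
    using tr[OF assms(1), of \<alpha> \<beta>] tr[OF assms(2), of \<alpha>' \<beta>'] eq one_nonzero by simp
  then have J: "\<beta> *\<^sub>R J = \<beta>' *\<^sub>R J'"
    using eq by simp
  then have "(\<beta> *\<^sub>R J) \<odot> (\<beta> *\<^sub>R J) = (\<beta>' *\<^sub>R J') \<odot> (\<beta>' *\<^sub>R J')"
    by simp
  then have "\<beta> * \<beta> = \<beta>' * \<beta>'"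
    using assms(1,2) one_nonzero by (simp add: mult_simps imaginary_units_def)
  then consider "\<beta>' = \<beta>" | "\<beta>' = - \<beta>"
    by (metis square_eq_iff)
  then show thesis
  proof cases
    case 1
    then show ?thesis using J \<alpha> that by (cases "\<beta> = 0") auto
  next
    case 2
    have "\<beta> \<noteq> 0 \<Longrightarrow> J' = - J"
    proof -
      assume "\<beta> \<noteq> 0"
      moreover have "\<beta> *\<^sub>R J' = \<beta> *\<^sub>R (- J)" using J 2 by simp
      ultimately show "J' = - J" by (simp only: scaleR_cancel_left) simp
    qed
    then show ?thesis using 2 \<alpha> that by (cases "\<beta> = 0") auto
  qed
qed

lemma slice_eq:
  assumes F: "stem_function D F" and D: "Complex \<alpha> \<beta> \<in> D" and J: "J \<in> imaginary_units A"
  shows "slice A F (areal A \<alpha> + \<beta> *\<^sub>R J) =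
    fst (F (Complex \<alpha> \<beta>)) + J \<odot> snd (F (Complex \<alpha> \<beta>))"
  unfolding slice_def
proof (rule the_equality)
  show "\<exists>\<alpha>' \<beta>' J'. J' \<in> imaginary_units A \<and>
      areal A \<alpha> + \<beta> *\<^sub>R J = areal A \<alpha>' + \<beta>' *\<^sub>R J' \<and>
      fst (F (Complex \<alpha> \<beta>)) + J \<odot> snd (F (Complex \<alpha> \<beta>)) =
      fst (F (Complex \<alpha>' \<beta>')) + J' \<odot> snd (F (Complex \<alpha>' \<beta>'))"
    using J by blast
next
  fix v
  assume "\<exists>\<alpha>' \<beta>' J'. J' \<in> imaginary_units A \<and>
      areal A \<alpha> + \<beta> *\<^sub>R J = areal A \<alpha>' + \<beta>' *\<^sub>R J' \<and>
      v = fst (F (Complex \<alpha>' \<beta>')) + J' \<odot> snd (F (Complex \<alpha>' \<beta>'))"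
  then obtain \<alpha>' \<beta>' J' where J': "J' \<in> imaginary_units A"
    and eq: "areal A \<alpha> + \<beta> *\<^sub>R J = areal A \<alpha>' + \<beta>' *\<^sub>R J'"
    and v: "v = fst (F (Complex \<alpha>' \<beta>')) + J' \<odot> snd (F (Complex \<alpha>' \<beta>'))"
    by blast
  have cnj_F: "F (Complex \<alpha> (- \<beta>)) = (fst (F (Complex \<alpha> \<beta>)), - snd (F (Complex \<alpha> \<beta>)))"
    using F D unfolding stem_function_def by (metis complex_cnj)
  from J J' eq show "v = fst (F (Complex \<alpha> \<beta>)) + J \<odot> snd (F (Complex \<alpha> \<beta>))"
  proof (cases rule: decomposition_cases)
    case 1
    then have "snd (F (Complex \<alpha> \<beta>)) = - snd (F (Complex \<alpha> \<beta>))"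
      using cnj_F by (metis minus_zero snd_conv)
    then have "snd (F (Complex \<alpha> \<beta>)) = 0"
      by (simp add: eq_neg_iff_add_eq_0 flip: scaleR_2)
    then show ?thesis using v 1 by (simp add: mult_simps)
  next
    case 2
    then show ?thesis using v by simp
  next
    case 3
    then show ?thesis using v cnj_F by (simp add: mult_simps)
  qed
qed

lemma stem_function_poly_stem: "stem_function UNIV (poly_stem a m)"
  unfolding stem_function_def poly_stem_def
  by (simp add: sum_negf flip: complex_cnj_power)

lemma apow_decomposition:
  assumes "J \<in> imaginary_units A"
  shows "apow A (areal A \<alpha> + \<beta> *\<^sub>R J) j =
    Re (Complex \<alpha> \<beta> ^ j) *\<^sub>R \<one> + Im (Complex \<alpha> \<beta> ^ j) *\<^sub>R J"
  using assms
  by (induction j) (simp_all add: areal_def mult_simps imaginary_units_def algebra_simps)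

lemma slice_poly_stem:
  assumes "x \<in> slice_domain A UNIV"
  shows "slice A (poly_stem a m) x = poly_fun A a m x"
proof -
  obtain \<alpha> \<beta> J where J: "J \<in> imaginary_units A" and x: "x = areal A \<alpha> + \<beta> *\<^sub>R J"
    using assms by (auto simp: slice_domain_def)
  have lin: "linear (\<lambda>y. J \<odot> y)"
    using bilinear_mult by (simp add: bilinear_def)
  show ?thesis
    unfolding x slice_eq[OF stem_function_poly_stem UNIV_I J] poly_fun_def apow_decomposition[OF J]
    by (simp add: poly_stem_def mult_simps linear_sum[OF lin] sum.distrib)
qed

lemma slice_domain_UNIV:
  assumes "imaginary_units A \<noteq> {}"
  shows "slice_domain A UNIV = quadratic_cone A"
proof (intro equalityI subsetI)
  fix x
  assume "x \<in> slice_domain A UNIV"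
  then obtain \<alpha> \<beta> J where J: "J \<in> imaginary_units A" and x: "x = areal A \<alpha> + \<beta> *\<^sub>R J"
    by (auto simp: slice_domain_def)
  have c: "aconj A x = areal A \<alpha> - \<beta> *\<^sub>R J"
    unfolding x
    by (simp add: linear_add[OF linear_conj] conj_real linear_scale[OF linear_conj]
        conj_imaginary_unit[OF J])
  have t: "atrace A x = areal A (2 * \<alpha>)"
    unfolding atrace_def c by (simp add: x areal_def flip: scaleR_left_distrib)
  have n: "anorm A x = areal A (\<alpha>\<^sup>2 + \<beta>\<^sup>2)"
    using J unfolding anorm_def c
    by (simp add: x imaginary_units_def areal_def mult_simps algebra_simps power2_eq_square)
  show "x \<in> quadratic_cone A"
  proof (cases "\<beta> = 0")
    case True
    then show ?thesis by (simp add: x quadratic_cone_def)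
  next
    case False
    then have "4 * (\<alpha>\<^sup>2 + \<beta>\<^sup>2) > (2 * \<alpha>)\<^sup>2"
      by (simp add: power_mult_distrib)
    then show ?thesis using t n unfolding quadratic_cone_def by blast
  qed
next
  fix x
  assume "x \<in> quadratic_cone A"
  then consider r where "x = areal A r"
    | t n where "atrace A x = areal A t" "anorm A x = areal A n" "4 * n > t\<^sup>2"
    by (auto simp: quadratic_cone_def)
  then show "x \<in> slice_domain A UNIV"
  proof cases
    case 1
    obtain J where "J \<in> imaginary_units A" using assms by blast
    moreover have "x = areal A r + 0 *\<^sub>R J" using 1 by simp
    ultimately show ?thesis unfolding slice_domain_def by blast
  next
    case 2
    define s where "s = sqrt (n - t\<^sup>2 / 4)"
    have s: "s > 0" "s * s = n - t\<^sup>2 / 4"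
      using 2(3) by (auto simp: s_def)
    define z where "z = x - areal A (t / 2)"
    have cx: "aconj A x = areal A t - x"
      using 2(1) by (simp add: atrace_def algebra_simps)
    have cz: "aconj A z = - z"
      by (simp add: z_def linear_diff[OF linear_conj] conj_real cx)
         (simp add: areal_def algebra_simps flip: scaleR_left_distrib)
    have xx: "x \<odot> x = t *\<^sub>R x - n *\<^sub>R \<one>"
      using 2(2) by (simp add: anorm_def cx mult_simps areal_def algebra_simps)
    have zz: "z \<odot> z = - ((s * s) *\<^sub>R \<one>)"
      by (simp add: z_def mult_simps areal_def xx s(2) algebra_simps power2_eq_square
          flip: scaleR_left_distrib)
    define J where "J = (1 / s) *\<^sub>R z"
    have cJ: "aconj A J = - J"
      by (simp add: J_def linear_scale[OF linear_conj] cz)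
    have JJ: "J \<odot> J = - \<one>"
      using s(1) by (simp add: J_def mult_simps zz)
    have "atrace A J = areal A 0" "anorm A J = areal A 1"
      by (simp_all add: atrace_def anorm_def cJ mult_simps JJ areal_def)
    then have "J \<in> imaginary_units A"
      using JJ by (force simp: imaginary_units_def quadratic_cone_def)
    moreover have "x = areal A (t / 2) + s *\<^sub>R J"
      using s(1) by (simp add: J_def z_def)
    ultimately show ?thesis unfolding slice_domain_def by blast
  qed
qed

end

end

theory Submission
  imports Defs "HOL-Computational_Algebra.Fundamental_Theorem_Algebra"
begin

text \<open>
  Admissibility forces \<open>n(F\<^sub>1)\<close>, \<open>n(F\<^sub>2)\<close> and \<open>t(F\<^sub>1 F\<^sub>2\<^sup>c)\<close> to be real, so \<open>N(p)\<close> is induced by an ordinary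
  polynomial with real coefficients, of degree \<open>2m\<close> because \<open>n(a\<^sub>m) \<noteq> 0\<close>. A complex root \<open>\<alpha> + i\<beta>\<close> of
  it means that \<open>F\<^sub>1\<close> and \<open>F\<^sub>2\<close> have equal norms and are orthogonal there, which by the inverse
  property of alternative algebras amounts to \<open>F\<^sub>1 + J F\<^sub>2 = 0\<close> for some imaginary unit \<open>J\<close>: the
  sphere of \<open>\<alpha> + i\<beta>\<close> contains a zero of \<open>p\<close>. Dividing by powers of \<open>\<Delta>\<^sub>y\<close> reduces to divisibility of
  complex polynomials, so the multiplicity of \<open>y\<close> is the order of the root if it is not real, and
  half the order if it is real. Real roots have even order since \<open>N(p)\<close> does not change sign on the
  real axis, and the multiplicities add up to \<open>m\<close>.
\<close>

section \<open>Complex polynomials with real coefficients\<close>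

lemma map_poly_cnj_mult: "map_poly cnj (p * q) = map_poly cnj p * map_poly cnj q"
  by (simp add: fun_eq_iff flip: poly_eq_poly_eq_iff)

lemma map_poly_cnj_power: "map_poly cnj (p ^ n) = map_poly cnj p ^ n"
  by (induction n) (simp_all add: map_poly_cnj_mult)

text \<open>Conjugating the coefficients of \<open>p = [:- b, 1:] ^ n * q\<close> fixes
  \<open>p\<close> and moves the root \<open>b\<close> to \<open>cnj b\<close>. Using this at
  \<open>a\<close> and at \<open>cnj a\<close> gives both directions.\<close>

lemma order_cnj:
  assumes "p \<noteq> 0" "map_poly cnj p = p"
  shows "order (cnj a) p = order a p"
proof -
  have "[:- cnj b, 1:] ^ n dvd p" if dvd: "[:- b, 1:] ^ n dvd p" for b n
  proof -
    obtain q where "p = [:- b, 1:] ^ n * q"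
      using dvd by blast
    then have "p = map_poly cnj ([:- b, 1:] ^ n * q)"
      using assms(2) by simp
    also have "\<dots> = [:- cnj b, 1:] ^ n * map_poly cnj q"
      by (simp add: map_poly_cnj_mult map_poly_cnj_power map_poly_pCons)
    finally show ?thesis
      by simp
  qed
  from this[of a] this[of "cnj a"] have "[:- cnj a, 1:] ^ n dvd p \<longleftrightarrow> [:- a, 1:] ^ n dvd p" for n
    by auto
  then show ?thesis
    using assms(1) by (metis order_divides le_antisym order_refl)
qed

text \<open>A continuous quotient \<open>g\<close> suffices, and this is all that divisibility of
  slice functions will supply. If the order \<open>k\<close> at \<open>a\<close> were below
  \<open>n\<close>, cancelling \<open>(z - a) ^ k\<close> off \<open>a\<close> and letting z tend to
  \<open>a\<close> would make the cofactor \<open>q\<close> vanish at \<open>a\<close>.\<close>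

lemma linear_power_dvdI:
  fixes p :: "complex poly"
  assumes eq: "\<And>z. poly p z = (z - a) ^ n * g z" and g: "isCont g a"
  shows "[:- a, 1:] ^ n dvd p"
proof (cases "p = 0")
  case False
  define k where "k = order a p"
  obtain q where q: "p = [:- a, 1:] ^ k * q" and "\<not> [:- a, 1:] dvd q"
    using order_decomp[OF False] unfolding k_def by blast
  then have qa: "poly q a \<noteq> 0"
    by (simp add: poly_eq_0_iff_dvd)
  have "\<not> k < n"
  proof
    assume k: "k < n"
    have "poly q z = (z - a) ^ (n - k) * g z" if "z \<noteq> a" for z
    proof -
      have "(z - a) ^ k * poly q z = (z - a) ^ k * ((z - a) ^ (n - k) * g z)"
        using eq[of z] k by (simp add: q mult.assoc[symmetric] power_add[symmetric])
      then show ?thesis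
        using that by simp
    qed
    then have "\<forall>\<^sub>F z in at a. (z - a) ^ (n - k) * g z = poly q z"
      by (simp add: eventually_at_filter)
    moreover have "((\<lambda>z. (z - a) ^ (n - k) * g z) \<longlongrightarrow> (a - a) ^ (n - k) * g a) (at a)"
      using g by (intro tendsto_intros) (simp add: isCont_def)
    ultimately have "(poly q \<longlongrightarrow> (a - a) ^ (n - k) * g a) (at a)"
      by (rule Lim_transform_eventually[rotated])
    moreover have "(poly q \<longlongrightarrow> poly q a) (at a)"
      using poly_isCont[of a q] by (simp add: isCont_def)
    ultimately have "poly q a = (a - a) ^ (n - k) * g a"
      by (intro tendsto_unique[of "at a"]) auto
    then show False
      using qa k by simp
  qed
  then show ?thesis
    by (simp add: order_divides k_def)
qed simp

text \<open>For odd \<open>k\<close> the factor \<open>(x - r) ^ k\<close> changes sign at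
  \<open>r\<close> while \<open>p\<close> does not. The one-sided limits of the cofactor then force
  its real nonzero value at \<open>r\<close> to be both nonnegative and nonpositive.\<close>

lemma even_order_real_root:
  fixes p :: "complex poly"
  assumes p: "p \<noteq> 0" "map_poly cnj p = p" and pos: "\<And>x::real. Re (poly p x) \<ge> 0"
  shows "even (order (of_real r) p)"
proof (rule ccontr)
  define k where "k = order (of_real r) p"
  assume "odd (order (of_real r) p)"
  then have odd: "odd k"
    by (simp add: k_def)
  obtain q where q: "p = [:- of_real r, 1:] ^ k * q" and "\<not> [:- of_real r, 1:] dvd q"
    using order_decomp[OF p(1)] unfolding k_def by blast
  then have qr: "poly q r \<noteq> 0"
    by (simp add: poly_eq_0_iff_dvd)
  have "map_poly cnj ([:- of_real r, 1:] ^ k) * map_poly cnj q = [:- of_real r, 1:] ^ k * q"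
    using p(2) by (simp add: q map_poly_cnj_mult)
  then have "[:- of_real r, 1:] ^ k * map_poly cnj q = [:- of_real r, 1:] ^ k * q"
    by (simp add: map_poly_cnj_power map_poly_pCons)
  then have cnj_q: "map_poly cnj q = q"
    by simp
  then have "cnj (poly q r) = poly q r"
    by (metis complex_cnj_complex_of_real poly_cnj)
  then have "poly q r \<in> \<real>"
    by (simp add: Reals_cnj_iff)
  then have Re_q: "Re (poly q r) \<noteq> 0"
    using qr by (simp add: complex_eq_iff complex_is_Real_iff)
  have prod: "Re (poly p x) = (x - r) ^ k * Re (poly q x)" for x :: real
    by (simp add: q flip: of_real_diff of_real_power)
  have lim: "((\<lambda>x. Re (poly q (complex_of_real x))) \<longlongrightarrow> Re (poly q r)) (at r within S)" for S
    by (intro tendsto_intros)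
  have "Re (poly q r) \<ge> 0"
  proof (rule tendsto_lowerbound[OF lim[of "{r<..}"]])
    have "Re (poly q x) \<ge> 0" if "x > r" for x :: real
    proof -
      have "(x - r) ^ k > 0"
        using that by simp
      then show ?thesis
        using pos[of x] unfolding prod zero_le_mult_iff by linarith
    qed
    then show "\<forall>\<^sub>F x in at_right r. 0 \<le> Re (poly q (complex_of_real x))"
      unfolding eventually_at_filter by auto
  qed simp
  moreover have "Re (poly q r) \<le> 0"
  proof (rule tendsto_upperbound[OF lim[of "{..<r}"]])
    have "Re (poly q x) \<le> 0" if "x < r" for x :: real
    proof -
      have "(x - r) ^ k < 0"
        using odd that by simp
      then show ?thesis
        using pos[of x] unfolding prod zero_le_mult_iff by linarith
    qed
    then show "\<forall>\<^sub>F x in at_left r. Re (poly q (complex_of_real x)) \<le> 0"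
      unfolding eventually_at_filter by auto
  qed simp
  ultimately show False
    using Re_q by simp
qed

lemma sum_order_eq_degree:
  fixes p :: "complex poly"
  assumes "p \<noteq> 0"
  shows "(\<Sum>z | poly p z = 0. order z p) = degree p"
  using size_proots_complex[of p] assms by (simp add: size_multiset_overloaded_eq)

text \<open>Nonreal roots come in conjugate pairs of equal order, so the upper half plane carries
  half of their total; for a real root the order itself is halved. Each sphere will correspond to
  one root with \<open>Im z \<ge> 0\<close>.\<close>

lemma sum_half_orders:
  fixes p :: "complex poly"
  assumes p: "p \<noteq> 0" "map_poly cnj p = p" and even: "\<And>r::real. even (order (of_real r) p)"
  shows "2 * (\<Sum>z | poly p z = 0 \<and> Im z \<ge> 0. if Im z = 0 then order z p div 2 else order z p) =
    degree p"
proof -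
  define U where "U = {z. poly p z = 0 \<and> Im z > 0}"
  define R where "R = {z. poly p z = 0 \<and> Im z = 0}"
  have fin: "finite U" "finite R" "finite (cnj ` U)"
    using poly_roots_finite[OF p(1)] by (auto simp: U_def R_def intro: finite_subset[rotated])
  have root_cnj: "poly p (cnj z) = 0 \<longleftrightarrow> poly p z = 0" for z
    using p(2) poly_cnj[of p z] by auto
  have cU: "cnj ` U = {z. poly p z = 0 \<and> Im z < 0}"
    using root_cnj by (auto simp: U_def intro!: image_eqI[of _ cnj "cnj _"])
  have split: "{z. poly p z = 0} = U \<union> cnj ` U \<union> R" "{z. poly p z = 0 \<and> Im z \<ge> 0} = U \<union> R"
    unfolding cU by (auto simp: U_def R_def)
  have disj: "U \<inter> cnj ` U = {}" "(U \<union> cnj ` U) \<inter> R = {}" "U \<inter> R = {}"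
    unfolding cU by (auto simp: U_def R_def)
  have "(\<Sum>z\<in>cnj ` U. order z p) = (\<Sum>z\<in>U. order z p)"
    by (subst sum.reindex) (auto simp: inj_on_def order_cnj[OF p])
  then have "degree p = 2 * (\<Sum>z\<in>U. order z p) + (\<Sum>z\<in>R. order z p)"
    using sum_order_eq_degree[OF p(1)] fin disj by (simp add: split sum.union_disjoint)
  moreover have "(\<Sum>z\<in>R. order z p) = (\<Sum>z\<in>R. 2 * (order z p div 2))"
  proof (intro sum.cong refl)
    fix z assume "z \<in> R"
    then have "z = of_real (Re z)" by (simp add: R_def complex_eq_iff)
    then show "order z p = 2 * (order z p div 2)" using even by (metis dvd_mult_div_cancel)
  qed
  moreover have "(\<Sum>z | poly p z = 0 \<and> Im z \<ge> 0. if Im z = 0 then order z p div 2 else order z p) =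
      (\<Sum>z\<in>U. order z p) + (\<Sum>z\<in>R. order z p div 2)"
    unfolding split using fin disj
    by (subst sum.union_disjoint) (auto simp: U_def R_def intro!: arg_cong2[of _ _ _ _ "(+)"] sum.cong)
  ultimately show ?thesis
    by (simp add: sum_distrib_left)
qed

section \<open>Inverses in alternative algebras\<close>

context alternative_star_algebra
begin

section \<open>Associator and Moufang identities\<close>

lemma associator_skew_left: "associator A x y z = - associator A y x z"
  using alternating(1)[of "x + y" z] alternating(1)[of x z] alternating(1)[of y z]
  by (simp add: associator_def mult_simps algebra_simps)

lemma associator_skew_right: "associator A x y z = - associator A x z y"
  using alternating(3)[of x "y + z"] alternating(3)[of x y] alternating(3)[of x z]
  by (simp add: associator_def mult_simps algebra_simps)

lemma associator_cycle: "associator A x y z = associator A y z x"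
  by (metis associator_skew_left associator_skew_right minus_minus)

text \<open>This follows from bilinearity alone; the Moufang identities below are specializations of
  it in which terms cancel by skew symmetry.\<close>

lemma teichmueller_identity:
  "associator A (w \<odot> x) y z - associator A w (x \<odot> y) z + associator A w x (y \<odot> z) =
    w \<odot> associator A x y z + associator A w x y \<odot> z"
  by (simp add: associator_def mult_simps)

lemma left_alternative: "x \<odot> (x \<odot> y) = (x \<odot> x) \<odot> y"
  using alternating(1)[of x y] by (simp add: associator_def)

lemma linearized_right_alternative:
  "(x \<odot> y) \<odot> z + (x \<odot> z) \<odot> y = x \<odot> (y \<odot> z + z \<odot> y)"
  using associator_skew_right[of x y z] by (simp add: associator_def mult_simps algebra_simps)

text \<open>The sum of the two associators is the linearized right alternative law for x x, minus x
  times the law for x; both equal (x x)(y z + z y).\<close>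

lemma associator_mult_skew: "associator A x (x \<odot> y) z = - associator A x (x \<odot> z) y"
proof -
  have "associator A x (x \<odot> y) z + associator A x (x \<odot> z) y =
      (((x \<odot> x) \<odot> y) \<odot> z + ((x \<odot> x) \<odot> z) \<odot> y) - x \<odot> ((x \<odot> y) \<odot> z + (x \<odot> z) \<odot> y)"
    by (simp add: associator_def mult_simps left_alternative)
  also have "\<dots> = 0"
    unfolding linearized_right_alternative left_alternative by simp
  finally show ?thesis
    by (simp add: eq_neg_iff_add_eq_0)
qed

text \<open>A Moufang identity in associator form. In the Teichmueller identity for x, y, x, z the
  first and third terms cancel.\<close>

lemma associator_mult_right: "associator A x (y \<odot> x) z = x \<odot> associator A x y z"
proof -
  have "associator A (x \<odot> y) x z = - associator A x (x \<odot> y) z"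
    by (rule associator_skew_left)
  moreover have "associator A x y (x \<odot> z) = associator A x (x \<odot> y) z"
    using associator_skew_right[of x y "x \<odot> z"] associator_mult_skew[of x z y] by simp
  ultimately show ?thesis
    using teichmueller_identity[of x y x z] associator_skew_left[of y x z]
    by (simp add: alternating mult_simps)
qed

text \<open>The companion Moufang identity, from the Teichmueller identity for z, x, y, x, where
  again the first and third terms cancel.\<close>

lemma associator_mult_left: "associator A x (x \<odot> y) z = associator A x y z \<odot> x"
proof -
  have "associator A (z \<odot> x) y x = - associator A x (y \<odot> x) z"
    by (metis (no_types) associator_cycle associator_skew_right associator_mult_right minus_minus
        bilinear_rneg[OF bilinear_mult])
  moreover have "associator A z x (y \<odot> x) = associator A x (y \<odot> x) z"
    by (rule associator_cycle)
  moreover have "associator A z (x \<odot> y) x = - associator A x (x \<odot> y) z"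
    by (metis associator_cycle associator_skew_left)
  ultimately show ?thesis
    using teichmueller_identity[of z x y x] associator_cycle[of z x y]
    by (simp add: alternating mult_simps)
qed

text \<open>
  The associator \<open>a = (y, z, x)\<close> satisfies \<open>ay = za = 0\<close>, so that \<open>(a, y, z) = - r a\<close> whereas
  \<open>(y, z, a) = r a\<close>.
\<close>

lemma right_inverse_property:
  assumes yz: "y \<odot> z = areal A r" and zy: "z \<odot> y = areal A r" and r: "r \<noteq> 0"
  shows "(x \<odot> y) \<odot> z = r *\<^sub>R x"
proof -
  define a where "a = associator A y z x"
  have real_middle: "associator A u (areal A r) v = 0" for u v
    by (simp add: associator_def areal_def mult_simps)
  \<comment> \<open>The Moufang identities turn a y into (y, yz, x) and z a into -(z, yz, x); both
    vanish because yz is real.\<close>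
  have "a \<odot> y = 0"
    using associator_mult_left[of y z x] by (simp add: yz real_middle a_def)
  moreover have "z \<odot> a = 0"
    using associator_mult_right[of z y x] associator_skew_left[of z y x]
    by (simp add: yz real_middle a_def mult_simps)
  ultimately have "- (r *\<^sub>R a) = r *\<^sub>R a"
    using associator_cycle[of a y z] by (simp add: associator_def yz areal_def mult_simps)
  then have "(2 * r) *\<^sub>R a = 0"
    by (simp add: neg_eq_iff_add_eq_0 flip: scaleR_2)
  then have "associator A x y z = 0"
    using r associator_cycle[of x y z] by (simp add: a_def)
  then show ?thesis
    by (simp add: associator_def yz areal_def mult_simps)
qed

section \<open>The equation x + J y = 0 for an imaginary unit J\<close>

lemma normal_cone_cases:
  assumes "x \<in> normal_cone A"
  obtains "x = 0" | r where "r \<noteq> 0" "x \<odot> aconj A x = areal A r" "aconj A x \<odot> x = areal A r"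
  using assms by (auto simp: normal_cone_def anorm_def conj_conj)

lemma imaginary_unit_mult_twice:
  assumes "J \<in> imaginary_units A"
  shows "J \<odot> (J \<odot> x) = - x"
  using assms by (simp add: left_alternative imaginary_units_def mult_simps)

lemma imaginary_unitI:
  assumes "J \<odot> J = - \<one>" "aconj A J = - J"
  shows "J \<in> imaginary_units A"
proof -
  have "atrace A J = areal A 0" "anorm A J = areal A 1"
    using assms by (simp_all add: atrace_def anorm_def mult_simps areal_def)
  then show ?thesis
    using assms by (force simp: imaginary_units_def quadratic_cone_def)
qed

text \<open>
  \<open>J\<close> must be \<open>- x y\<^sup>c / n(y)\<close>. Since \<open>J\<^sup>2\<close> cannot be computed by reassociation, it is obtained from
  \<open>J y = - x\<close> and \<open>J x = y\<close>.
\<close>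

lemma imaginary_unit_of_isotropic_pair:
  assumes x: "x \<in> normal_cone A" and y: "y \<in> normal_cone A"
    and n: "x \<odot> aconj A x = y \<odot> aconj A y"
    and t: "x \<odot> aconj A y + y \<odot> aconj A x = 0"
    and ex: "imaginary_units A \<noteq> {}"
  shows "\<exists>J\<in>imaginary_units A. x + J \<odot> y = 0"
  using y
proof (cases rule: normal_cone_cases)
  \<comment> \<open>Here n(x) = n(y) = 0, so x = 0 as well, and any imaginary unit will do.\<close>
  case 1
  have "x = 0"
    using x
  proof (cases rule: normal_cone_cases)
    case 2
    then show ?thesis using n 1 one_nonzero by (simp add: mult_simps areal_def)
  qed
  then show ?thesis
    using 1 ex by (auto simp: mult_simps)
next
  case (2 r)
  then have ny: "y \<odot> aconj A y = areal A r" "aconj A y \<odot> y = areal A r" by auto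
  have nx: "x \<odot> aconj A x = areal A r" using n ny by simp
  have nx': "aconj A x \<odot> x = areal A r"
    using x
  proof (cases rule: normal_cone_cases)
    case 1
    then have "areal A r = 0" using nx by (simp add: mult_simps)
    then show ?thesis using \<open>r \<noteq> 0\<close> one_nonzero by (simp add: areal_def)
  next
    case (2 s)
    then show ?thesis using nx by simp
  qed
  define J where "J = (- 1 / r) *\<^sub>R (x \<odot> aconj A y)"
  \<comment> \<open>Orthogonality gives a second form of \<open>J\<close>. With it the inverse
    property computes J x, and comparing both forms gives that the conjugate of \<open>J\<close> is
    \<open>- J\<close>.\<close>
  have J': "J = (1 / r) *\<^sub>R (y \<odot> aconj A x)"
    using t by (simp add: J_def add_eq_0_iff)
  have Jy: "J \<odot> y = - x"
    using right_inverse_property[OF ny(2) ny(1) \<open>r \<noteq> 0\<close>, of x] \<open>r \<noteq> 0\<close>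
    by (simp add: J_def mult_simps)
  have Jx: "J \<odot> x = y"
    using right_inverse_property[OF nx' nx \<open>r \<noteq> 0\<close>, of y] \<open>r \<noteq> 0\<close>
    by (simp add: J' mult_simps)
  have "(J \<odot> J) \<odot> y = - y"
    using Jx Jy by (simp add: mult_simps flip: left_alternative)
  \<comment> \<open>Multiplying on the right by the conjugate of y cancels y, by the inverse
    property.\<close>
  then have "((J \<odot> J) \<odot> y) \<odot> aconj A y = - areal A r"
    by (simp add: mult_simps ny)
  then have "r *\<^sub>R (J \<odot> J) = r *\<^sub>R (- \<one>)"
    unfolding right_inverse_property[OF ny \<open>r \<noteq> 0\<close>] by (simp add: areal_def)
  then have "J \<odot> J = - \<one>"
    using \<open>r \<noteq> 0\<close> by (simp only: scaleR_cancel_left) simp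
  moreover have "aconj A J = - J"
    by (subst J_def) (simp add: J' linear_scale[OF linear_conj] conj_mult conj_conj)
  ultimately show ?thesis
    using Jy by (intro bexI[of _ J] imaginary_unitI) simp_all
qed

text \<open>With x = - J y and n(y) = r, the inverse property gives - r J for x times the conjugate
  of y; conjugation gives r J for the opposite product. Multiplying the latter by x in two ways
  yields n(x) y = r y.\<close>

lemma isotropic_pair_of_imaginary_unit:
  assumes x: "x \<in> normal_cone A" and y: "y \<in> normal_cone A"
    and J: "J \<in> imaginary_units A" and eq: "x + J \<odot> y = 0"
  shows "x \<odot> aconj A x = y \<odot> aconj A y" "x \<odot> aconj A y + y \<odot> aconj A x = 0"
proof -
  have x_eq: "x = - (J \<odot> y)" using eq by (simp add: add_eq_0_iff2)
  have "J \<odot> x = y"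
    unfolding x_eq using imaginary_unit_mult_twice[OF J] by (simp add: mult_simps)
  have "x \<odot> aconj A x = y \<odot> aconj A y \<and> x \<odot> aconj A y + y \<odot> aconj A x = 0"
    using y
  proof (cases rule: normal_cone_cases)
    case 1
    then show ?thesis
      by (simp add: x_eq mult_simps linear_0[OF linear_conj])
  next
    case (2 r)
    have xy: "x \<odot> aconj A y = - (r *\<^sub>R J)"
      using right_inverse_property[OF 2(2,3,1), of J] by (simp add: x_eq mult_simps)
    then have "aconj A (x \<odot> aconj A y) = r *\<^sub>R J"
      by (simp add: linear_neg[OF linear_conj] linear_scale[OF linear_conj]
          conj_imaginary_unit[OF J])
    then have yx: "y \<odot> aconj A x = r *\<^sub>R J"
      by (simp add: conj_mult conj_conj)
    have "x \<odot> aconj A x = areal A r"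
      using x
    proof (cases rule: normal_cone_cases)
      case 1
      then have "y = 0" using \<open>J \<odot> x = y\<close> by (simp add: mult_simps)
      then show ?thesis using 1 2 by (simp add: mult_simps)
    next
      case (2 s)
      have "s *\<^sub>R y = r *\<^sub>R y"
        using right_inverse_property[OF 2(3,2,1), of y] \<open>J \<odot> x = y\<close>
        by (auto simp: yx mult_simps)
      moreover have "y \<noteq> 0"
        using 2 one_nonzero by (auto simp: x_eq areal_def mult_simps)
      ultimately show ?thesis using 2 by simp
    qed
    then show ?thesis using 2 xy yx by simp
  qed
  then show "x \<odot> aconj A x = y \<odot> aconj A y" "x \<odot> aconj A y + y \<odot> aconj A x = 0" by auto
qed

end

section \<open>The polynomial inducing the normal function\<close>

text \<open>The inner product serves only to choose a linear functional sending
  \<open>areal A r\<close> to r; its values on nonreal elements are arbitrary.\<close>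

definition real_part :: "'a::euclidean_space star_algebra \<Rightarrow> 'a \<Rightarrow> real" where
  "real_part A v = (v \<bullet> \<one>\<^bsub>A\<^esub>) / (\<one>\<^bsub>A\<^esub> \<bullet> \<one>\<^bsub>A\<^esub>)"

definition complex_stem :: "'a::euclidean_space star_algebra \<Rightarrow> complex \<Rightarrow> 'a \<times> 'a" where
  "complex_stem A u = (areal A (Re u), areal A (Im u))"

definition complex_part :: "'a::euclidean_space star_algebra \<Rightarrow> 'a \<times> 'a \<Rightarrow> complex" where
  "complex_part A v = Complex (real_part A (fst v)) (real_part A (snd v))"

text \<open>Single products of coefficients need not be real, so \<open>real_part\<close> is applied
  to each. Taking complex polynomials makes \<open>order\<close> and the fundamental theorem of
  algebra available.\<close>

definition normal_poly ::
    "'a::euclidean_space star_algebra \<Rightarrow> (nat \<Rightarrow> 'a) \<Rightarrow> nat \<Rightarrow> complex poly" where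
  "normal_poly A a m =
    (\<Sum>j\<le>m. \<Sum>k\<le>m. monom (of_real (real_part A (a j \<odot>\<^bsub>A\<^esub> aconj A (a k)))) (j + k))"

lemma linear_real_part: "linear (real_part A)"
  by (rule linearI) (simp_all add: real_part_def inner_add_left add_divide_distrib)

lemma map_poly_cnj_normal_poly: "map_poly cnj (normal_poly A a m) = normal_poly A a m"
  by (rule poly_eqI) (simp add: coeff_map_poly normal_poly_def coeff_sum if_distrib[of cnj] cong: if_cong)

lemma degree_normal_poly_le: "degree (normal_poly A a m) \<le> 2 * m"
  by (rule degree_le) (auto simp: normal_poly_def coeff_sum intro!: sum.neutral)

lemma coeff_normal_poly_top:
  "coeff (normal_poly A a m) (2 * m) = of_real (real_part A (a m \<odot>\<^bsub>A\<^esub> aconj A (a m)))"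
proof -
  have "coeff (normal_poly A a m) (2 * m) =
      (\<Sum>j\<le>m. \<Sum>k\<le>m. if j + k = 2 * m then of_real (real_part A (a j \<odot>\<^bsub>A\<^esub> aconj A (a k))) else 0)"
    by (simp add: normal_poly_def coeff_sum)
  also have "\<dots> = (\<Sum>j\<le>m. if j = m then
      \<Sum>k\<le>m. if k = m then of_real (real_part A (a m \<odot>\<^bsub>A\<^esub> aconj A (a m))) else 0 else 0)"
  proof (intro sum.cong refl)
    fix j assume "j \<in> {..m}"
    then have "j + k = 2 * m \<longleftrightarrow> j = m \<and> k = m" if "k \<le> m" for k
      using that by auto
    then show "(\<Sum>k\<le>m. if j + k = 2 * m then complex_of_real (real_part A (a j \<odot>\<^bsub>A\<^esub> aconj A (a k))) else 0) =
        (if j = m then \<Sum>k\<le>m. if k = m then of_real (real_part A (a m \<odot>\<^bsub>A\<^esub> aconj A (a m))) else 0 else 0)"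
      by (cases "j = m") (auto intro: sum.neutral cong: sum.cong if_cong)
  qed
  finally show ?thesis
    by simp
qed

context alternative_star_algebra
begin

section \<open>Stem functions with complex values\<close>

lemma real_part_areal [simp]: "real_part A (areal A r) = r"
  using one_nonzero by (simp add: real_part_def areal_def)

lemma complex_part_complex_stem [simp]: "complex_part A (complex_stem A u) = u"
  by (simp add: complex_part_def complex_stem_def)

lemma areal_eq_iff [simp]: "areal A r = areal A s \<longleftrightarrow> r = s"
  by (metis real_part_areal)

lemma areal_simps:
  "areal A 0 = 0" "areal A (r + s) = areal A r + areal A s"
  "areal A (r - s) = areal A r - areal A s" "areal A (- r) = - areal A r"
  by (simp_all add: areal_def algebra_simps)

lemma complex_stem_eq_iff [simp]: "complex_stem A u = complex_stem A v \<longleftrightarrow> u = v"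
  by (simp add: complex_stem_def complex_eq_iff)

lemma areal_mult: "areal A r \<odot> x = r *\<^sub>R x" "x \<odot> areal A r = r *\<^sub>R x"
  by (simp_all add: areal_def mult_simps)

lemma stem_mult_complex_stem:
  "stem_mult A (\<lambda>z. complex_stem A (u z)) (\<lambda>z. complex_stem A (v z)) =
    (\<lambda>z. complex_stem A (u z * v z))"
  by (simp add: stem_mult_def complex_stem_def areal_mult)
     (simp add: areal_def algebra_simps)

lemma stem_pow_complex_stem:
  "stem_pow A (\<lambda>z. complex_stem A (u z)) n = (\<lambda>z. complex_stem A (u z ^ n))"
  by (induction n) (simp_all add: stem_mult_complex_stem, simp add: complex_stem_def areal_def)

text \<open>\<open>complex_part\<close> is complex linear, so a factorization with an arbitrary
  \<open>G\<close> projects to a factorization of complex functions.\<close>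

lemma complex_part_stem_mult:
  "complex_part A (stem_mult A (\<lambda>z. complex_stem A (u z)) G z) = u z * complex_part A (G z)"
  by (simp add: stem_mult_def complex_stem_def areal_mult complex_part_def complex_eq_iff
      linear_diff[OF linear_real_part] linear_add[OF linear_real_part]
      linear_scale[OF linear_real_part])

lemma stem_function_complex_stem:
  assumes "map_poly cnj q = q"
  shows "stem_function UNIV (\<lambda>z. complex_stem A (poly q z))"
proof -
  have "poly q (cnj z) = cnj (poly q z)" for z
    using assms by (metis poly_cnj)
  then show ?thesis
    by (simp add: stem_function_def complex_stem_def areal_simps)
qed

lemma stem_function_stem_mult:
  assumes "stem_function D F" "stem_function D G"
  shows "stem_function D (stem_mult A F G)"
  using assms by (auto simp: stem_function_def stem_mult_def mult_simps)

lemma minus_imaginary_unit: "J \<in> imaginary_units A \<Longrightarrow> - J \<in> imaginary_units A"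
  by (rule imaginary_unitI)
    (simp_all add: mult_simps linear_neg[OF linear_conj] conj_imaginary_unit imaginary_units_def)

text \<open>The values at J and - J determine the stem function: their sum is twice the first
  component, and applying J once more recovers the second.\<close>

lemma stem_eqI:
  assumes F: "stem_function UNIV F" and G: "stem_function UNIV G"
    and ex: "imaginary_units A \<noteq> {}"
    and eq: "\<And>x. x \<in> slice_domain A UNIV \<Longrightarrow> slice A F x = slice A G x"
  shows "F z = G z"
proof -
  obtain J where J: "J \<in> imaginary_units A"
    using ex by blast
  have "slice A F (areal A (Re z) + Im z *\<^sub>R I) = slice A G (areal A (Re z) + Im z *\<^sub>R I)"
    if "I \<in> imaginary_units A" for I
    using that by (intro eq) (auto simp: slice_domain_def)
  then have *: "fst (F z) + I \<odot> snd (F z) = fst (G z) + I \<odot> snd (G z)"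
    if "I \<in> imaginary_units A" for I
    using that slice_eq[OF F UNIV_I that, of "Re z" "Im z"] slice_eq[OF G UNIV_I that, of "Re z" "Im z"]
    by simp
  have "2 *\<^sub>R fst (F z) = 2 *\<^sub>R fst (G z)"
    using arg_cong2[OF *[OF J] *[OF minus_imaginary_unit[OF J]], of "(+)"]
    by (simp add: mult_simps scaleR_2)
  then have 1: "fst (F z) = fst (G z)"
    by simp
  then have "J \<odot> (J \<odot> snd (F z)) = J \<odot> (J \<odot> snd (G z))"
    using *[OF J] by simp
  then have "snd (F z) = snd (G z)"
    by (simp add: imaginary_unit_mult_twice[OF J])
  with 1 show ?thesis
    by (simp add: prod_eq_iff)
qed

lemma mult_conj_sum:
  "(\<Sum>j\<in>S. p j *\<^sub>R a j) \<odot> aconj A (\<Sum>k\<in>S. q k *\<^sub>R a k) =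
    (\<Sum>j\<in>S. \<Sum>k\<in>S. (p j * q k) *\<^sub>R (a j \<odot> aconj A (a k)))"
proof -
  have *: "linear (\<lambda>y. x \<odot> y)" "linear (\<lambda>y. y \<odot> x)" for x
    using bilinear_mult by (simp_all add: bilinear_def)
  show ?thesis
    by (simp add: linear_sum[OF *(2)] mult_simps)
      (simp add: linear_sum[OF linear_conj] linear_scale[OF linear_conj] linear_sum[OF *(1)]
        mult_simps scaleR_sum_right)
qed

text \<open>The linear \<open>real_part\<close> passes through the double sums. Admissibility enters
  later, to show that the normal stem function is determined by its complex part.\<close>

lemma complex_part_normal_stem:
  "complex_part A (normal_stem A (poly_stem a m) z) = poly (normal_poly A a m) z"
proof -
  define c where "c j k = real_part A (a j \<odot> aconj A (a k))" for j k
  have product: "real_part A ((\<Sum>j\<le>m. p j *\<^sub>R a j) \<odot> aconj A (\<Sum>k\<le>m. q k *\<^sub>R a k)) =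
      (\<Sum>j\<le>m. \<Sum>k\<le>m. p j * q k * c j k)" for p q
    by (simp add: mult_conj_sum linear_sum[OF linear_real_part] linear_scale[OF linear_real_part]
        c_def)
  have eval: "poly (normal_poly A a m) z = (\<Sum>j\<le>m. \<Sum>k\<le>m. of_real (c j k) * (z ^ j * z ^ k))"
    by (simp add: normal_poly_def poly_sum poly_monom power_add c_def)
  show ?thesis
  proof (rule complex_eqI)
    show "Re (complex_part A (normal_stem A (poly_stem a m) z)) = Re (poly (normal_poly A a m) z)"
      unfolding eval Re_sum complex_part_def normal_stem_def stem_mult_def stem_conj_def poly_stem_def
      by (simp add: linear_diff[OF linear_real_part] product algebra_simps
          flip: sum_subtractf)
    show "Im (complex_part A (normal_stem A (poly_stem a m) z)) = Im (poly (normal_poly A a m) z)"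
      unfolding eval Im_sum complex_part_def normal_stem_def stem_mult_def stem_conj_def poly_stem_def
      by (simp add: linear_add[OF linear_real_part] product algebra_simps
          flip: sum.distrib)
  qed
qed

section \<open>Consequences of admissibility\<close>

lemma anorm_real:
  assumes "x \<in> normal_cone A"
  shows "x \<odot> aconj A x = areal A (real_part A (x \<odot> aconj A x))"
  using assms
proof (cases rule: normal_cone_cases)
  case 1
  then show ?thesis by (simp add: mult_simps linear_0[OF linear_real_part] areal_simps)
qed simp

text \<open>Polarization: the trace is n(x + y) - n(x) - n(y), so the normal cone must also contain
  x + y.\<close>

lemma trace_real:
  assumes "span {x, y} \<subseteq> normal_cone A"
  shows "x \<odot> aconj A y + y \<odot> aconj A x = areal A (real_part A (x \<odot> aconj A y + y \<odot> aconj A x))"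
proof -
  have "x \<in> span {x, y}" "y \<in> span {x, y}" "x + y \<in> span {x, y}"
    by (auto intro: span_base span_add)
  then have "x \<in> normal_cone A" "y \<in> normal_cone A" "x + y \<in> normal_cone A"
    using assms by auto
  note real = this[THEN anorm_real]
  have eq: "x \<odot> aconj A y + y \<odot> aconj A x =
      (x + y) \<odot> aconj A (x + y) - x \<odot> aconj A x - y \<odot> aconj A y"
    by (simp add: mult_simps linear_add[OF linear_conj])
  also have "\<dots> = areal A (real_part A ((x + y) \<odot> aconj A (x + y)) - real_part A (x \<odot> aconj A x)
      - real_part A (y \<odot> aconj A y))"
    using real by (simp add: areal_simps)
  finally show ?thesis
    by simp
qed

lemma normal_stem_eq:
  assumes "admissible A D (poly_stem a m)" and z: "z \<in> D"
  shows "normal_stem A (poly_stem a m) z = complex_stem A (poly (normal_poly A a m) z)"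
proof -
  define x y where "x = fst (poly_stem a m z)" and "y = snd (poly_stem a m z)"
  have span: "span {x, y} \<subseteq> normal_cone A"
    using assms by (auto simp: admissible_def x_def y_def)
  then have "x \<in> normal_cone A" "y \<in> normal_cone A"
    by (auto intro: span_base)
  note real = this[THEN anorm_real] trace_real[OF span]
  have "normal_stem A (poly_stem a m) z =
      (x \<odot> aconj A x - y \<odot> aconj A y, x \<odot> aconj A y + y \<odot> aconj A x)"
    by (simp add: normal_stem_def stem_mult_def stem_conj_def x_def y_def)
  then obtain r s where "normal_stem A (poly_stem a m) z = (areal A r, areal A s)"
    using real by (metis areal_simps(3))
  then have "normal_stem A (poly_stem a m) z = complex_stem A (Complex r s)"
    by (simp add: complex_stem_def)
  then show ?thesis
    using complex_part_normal_stem[of a m z] by simp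
qed

text \<open>A real quadratic form without nonzero isotropic vectors is definite, so n(x) and n(y)
  cannot cancel unless x and y both vanish.\<close>

lemma definite_on_normal_span:
  assumes span: "span {x, y} \<subseteq> normal_cone A"
    and 0: "real_part A (x \<odot> aconj A x) + real_part A (y \<odot> aconj A y) = 0"
  shows "x = 0" "y = 0"
proof -
  have aniso: "v = 0" if "v \<in> span {x, y}" "real_part A (v \<odot> aconj A v) = 0" for v
  proof -
    have "v \<in> normal_cone A" using that span by blast
    then show ?thesis
      using that(2) by (cases rule: normal_cone_cases) auto
  qed
  have mem: "x \<in> span {x, y}" "y \<in> span {x, y}"
    by (auto intro: span_base)
  define p q b where "p = real_part A (x \<odot> aconj A x)" and "q = real_part A (y \<odot> aconj A y)"
    and "b = real_part A (x \<odot> aconj A y + y \<odot> aconj A x)"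
  have q: "q = - p" using 0 by (simp add: p_def q_def)
  have form: "real_part A ((x + v *\<^sub>R y) \<odot> aconj A (x + v *\<^sub>R y)) = p + b * v + q * v\<^sup>2" for v
    by (simp add: mult_simps linear_add[OF linear_conj] linear_scale[OF linear_conj] p_def q_def b_def
        linear_add[OF linear_real_part] linear_scale[OF linear_real_part] algebra_simps power2_eq_square)
  have "p = 0"
  proof (rule ccontr)
    assume p: "p \<noteq> 0"
    \<comment> \<open>A root of p + b v - p v^2, whose discriminant b^2 + 4 p^2 is positive; hence x
      + v y is isotropic.\<close>
    define v where "v = (b + sqrt (b\<^sup>2 + 4 * p\<^sup>2)) / (2 * p)"
    have "2 * p * v = b + sqrt (b\<^sup>2 + 4 * p\<^sup>2)"
      using p by (simp add: v_def)
    then have "(2 * p * v - b)\<^sup>2 = b\<^sup>2 + 4 * p\<^sup>2"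
      by simp
    then have "4 * p * (p + b * v + q * v\<^sup>2) = 0"
      by (simp add: q power2_eq_square algebra_simps)
    then have "p + b * v + q * v\<^sup>2 = 0"
      using p by simp
    then have "x + v *\<^sub>R y = 0"
      by (intro aniso) (auto simp: form intro: span_add span_scale mem)
    \<comment> \<open>Dependence of x and y is not yet absurd, but it gives p = v^2 q = - v^2
      p.\<close>
    then have "x = (- v) *\<^sub>R y"
      by (simp add: add_eq_0_iff2)
    then have "p = v\<^sup>2 * q"
      by (simp add: p_def q_def mult_simps linear_neg[OF linear_conj] linear_scale[OF linear_conj]
          linear_scale[OF linear_real_part] power2_eq_square)
    then have "p * (1 + v\<^sup>2) = 0"
      by (simp add: q algebra_simps)
    then show False
      using p by (smt (verit) mult_eq_0_iff zero_le_power2)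
  qed
  then show "x = 0" "y = 0"
    using aniso[of x] aniso[of y] mem q by (simp_all add: p_def q_def)
qed

section \<open>Multiplicities\<close>

text \<open>The derivative is multiplication by \<open>poly (pderiv q) z\<close> followed by the
  fixed linear embedding of the complex numbers. Written as a composition of bounded linear maps, it
  is visibly continuous in z.\<close>

lemma slice_regular_complex_stem:
  assumes "map_poly cnj q = q"
  shows "slice_regular UNIV (\<lambda>z. complex_stem A (poly q z))"
proof -
  have lin: "bounded_linear (complex_stem A)"
    unfolding linear_conv_bounded_linear[symmetric]
    by (rule linearI) (simp_all add: complex_stem_def areal_def algebra_simps)
  define S where "S = Blinfun (complex_stem A)"
  have S: "blinfun_apply S = complex_stem A"
    by (simp add: S_def bounded_linear_Blinfun_apply[OF lin])
  define F' where "F' z = S o\<^sub>L blinfun_mult_right (poly (pderiv q) z)" for z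
  have F': "blinfun_apply (F' z) = (\<lambda>u. complex_stem A (poly (pderiv q) z * u))" for z
    by (rule ext) (simp add: F'_def S)
  show ?thesis
    unfolding slice_regular_def
  proof (intro conjI exI[of _ F'] ballI allI)
    show "stem_function UNIV (\<lambda>z. complex_stem A (poly q z))"
      by (rule stem_function_complex_stem[OF assms])
    show "continuous_on UNIV F'"
      unfolding F'_def by (intro continuous_intros continuous_on_poly)
    show "((\<lambda>z. complex_stem A (poly q z)) has_derivative blinfun_apply (F' z)) (at z)" for z
    proof -
      have "(poly q has_derivative (\<lambda>u. poly (pderiv q) z * u)) (at z)"
        using poly_DERIV[of q z] by (simp add: has_field_derivative_def)
      from bounded_linear.has_derivative[OF lin this] show ?thesis
        by (simp add: F')
    qed
    show "blinfun_apply (F' z) (\<i> * u) =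
        (- snd (blinfun_apply (F' z) u), fst (blinfun_apply (F' z) u))" for z u
      by (simp add: F' complex_stem_def areal_def algebra_simps)
  qed
qed

text \<open>The slice quotient \<open>G\<close> may have values outside the complex numbers; its
  \<open>complex_part\<close> is still a continuous quotient, as \<open>linear_power_dvdI\<close>
  requires.\<close>

lemma slice_dvd_complex_stemD:
  assumes p: "map_poly cnj p = p" and q: "map_poly cnj q = q" and ex: "imaginary_units A \<noteq> {}"
    and dvd: "slice_dvd A UNIV (\<lambda>z. complex_stem A (poly p z)) (\<lambda>z. complex_stem A (poly q z))"
  obtains g where "continuous_on UNIV g" "\<And>z. poly q z = poly p z * g z"
proof -
  obtain G where G: "slice_regular UNIV G"
    and eq: "\<And>x. x \<in> slice_domain A UNIV \<Longrightarrow> slice A (\<lambda>z. complex_stem A (poly q z)) x =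
      slice A (stem_mult A (\<lambda>z. complex_stem A (poly p z)) G) x"
    using dvd by (auto simp: slice_dvd_def)
  have "stem_function UNIV G"
    using G by (simp add: slice_regular_def)
  then have "complex_stem A (poly q z) = stem_mult A (\<lambda>z. complex_stem A (poly p z)) G z" for z
    by (intro stem_eqI stem_function_stem_mult stem_function_complex_stem p q ex eq)
  then have "poly q z = poly p z * complex_part A (G z)" for z
    by (metis complex_part_complex_stem complex_part_stem_mult)
  moreover have "continuous_on UNIV (\<lambda>z. complex_part A (G z))"
  proof -
    have G_cont: "continuous_on UNIV G"
      using G unfolding slice_regular_def
      by (metis UNIV_I continuous_at_imp_continuous_on has_derivative_continuous)
    have real_cont: "continuous_on UNIV (real_part A)"
      by (rule linear_continuous_on) (simp add: linear_conv_bounded_linear[symmetric] linear_real_part)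
    show ?thesis
      unfolding complex_part_def
      by (rule continuous_on_Complex[OF
            continuous_on_compose2[OF real_cont continuous_on_fst[OF G_cont] subset_UNIV]
            continuous_on_compose2[OF real_cont continuous_on_snd[OF G_cont] subset_UNIV]])
  qed
  ultimately show thesis
    using that by blast
qed

text \<open>Cancelling \<open>p\<close> shows that the polynomial quotient has real coefficients,
  hence induces a slice regular function.\<close>

lemma slice_dvd_complex_stemI:
  assumes p: "map_poly cnj p = p" "p \<noteq> 0" and q: "map_poly cnj q = q" and dvd: "p dvd q"
  shows "slice_dvd A UNIV (\<lambda>z. complex_stem A (poly p z)) (\<lambda>z. complex_stem A (poly q z))"
proof -
  obtain r where r: "q = p * r"
    using dvd by blast
  have "p * map_poly cnj r = p * r"
    using map_poly_cnj_mult[of p r] p(1) q r by simp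
  then have "map_poly cnj r = r"
    using p(2) by simp
  then have "slice_regular UNIV (\<lambda>z. complex_stem A (poly r z))"
    by (rule slice_regular_complex_stem)
  then show ?thesis
    unfolding slice_dvd_def
    by (intro exI[of _ "\<lambda>z. complex_stem A (poly r z)"])
      (simp add: stem_mult_complex_stem r)
qed

text \<open>The right-hand side is free of \<open>J\<close>: the function depends only on the sphere
  of the point.\<close>

lemma delta_stem_eq:
  assumes J: "J \<in> imaginary_units A"
  shows "delta_stem A (areal A (Re w) + Im w *\<^sub>R J) =
    (\<lambda>z. complex_stem A (poly ([:- w, 1:] * [:- cnj w, 1:]) z))"
proof -
  define y where "y = areal A (Re w) + Im w *\<^sub>R J"
  have c: "aconj A y = areal A (Re w) - Im w *\<^sub>R J"
    by (simp add: y_def linear_add[OF linear_conj] conj_real linear_scale[OF linear_conj]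
        conj_imaginary_unit[OF J])
  have t: "atrace A y = (2 * Re w) *\<^sub>R \<one>"
    unfolding atrace_def c by (simp add: y_def areal_def flip: scaleR_left_distrib)
  have n: "anorm A y = ((Re w)\<^sup>2 + (Im w)\<^sup>2) *\<^sub>R \<one>"
    using J unfolding anorm_def c
    by (simp add: y_def imaginary_units_def areal_def mult_simps algebra_simps power2_eq_square)
  have "delta_stem A y z = complex_stem A (poly ([:- w, 1:] * [:- cnj w, 1:]) z)" for z
    by (simp add: delta_stem_def poly_stem_def t n numeral_2_eq_2 complex_stem_def areal_def
        algebra_simps)
  then show ?thesis
    unfolding y_def by blast
qed

text \<open>The s-th power of Delta corresponds to \<open>d ^ s\<close>. For nonreal
  \<open>w\<close> its two linear factors are distinct and have equal order in the normal
  polynomial; for real \<open>w\<close> they coincide, so each power uses up two orders.\<close>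

lemma zero_multiplicity_eq:
  assumes adm: "admissible A UNIV (poly_stem a m)" and J: "J \<in> imaginary_units A"
    and nz: "normal_poly A a m \<noteq> 0"
  shows "zero_multiplicity A UNIV (poly_stem a m) (areal A (Re w) + Im w *\<^sub>R J) =
    (if Im w = 0 then order w (normal_poly A a m) div 2 else order w (normal_poly A a m))"
    (is "_ = ?\<mu>")
proof -
  let ?N = "normal_poly A a m"
  define d where "d = [:- w, 1:] * [:- cnj w, 1:]"
  have d: "map_poly cnj d = d" "d \<noteq> 0"
    unfolding d_def by (simp_all only: map_poly_cnj_mult) (simp_all add: map_poly_pCons mult.commute)
  have poly_d: "poly d z = (z - w) * (z - cnj w)" for z
    by (simp add: d_def algebra_simps)
  have "d ^ s dvd ?N" if s: "s \<le> ?\<mu>" for s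
  proof (cases "Im w = 0")
    case True
    then have "cnj w = w" by (simp add: complex_eq_iff)
    then have "d ^ s = [:- w, 1:] ^ (2 * s)"
      by (simp add: d_def power_mult power2_eq_square)
    moreover have "2 * s \<le> order w ?N"
      using s True by simp
    ultimately show ?thesis
      by (simp add: order_divides)
  next
    case False
    then have "[:- w, 1:] ^ s dvd ?N"
      using s by (simp add: order_divides)
    then obtain q where q: "?N = [:- w, 1:] ^ s * q" by blast
    \<comment> \<open>Splitting off the factor at \<open>w\<close> leaves the order at
      \<open>cnj w\<close> unchanged, and by symmetry that is the order at \<open>w\<close>.\<close>
    have "order (cnj w) ([:- w, 1:] ^ s) = 0"
      using False by (intro order_0I) (auto simp: complex_eq_iff[of "cnj w" w])
    then have "order (cnj w) q = order w ?N"
      using order_mult[of "[:- w, 1:] ^ s" q "cnj w"] nz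
      by (simp flip: q add: order_cnj[OF nz map_poly_cnj_normal_poly])
    then have "[:- cnj w, 1:] ^ s dvd q"
      using s False by (simp add: order_divides)
    then show ?thesis
      unfolding d_def power_mult_distrib q by (rule mult_dvd_mono[OF dvd_refl])
  qed
  moreover have "s \<le> ?\<mu>" if "continuous_on UNIV g" and g: "\<And>z. poly ?N z = poly (d ^ s) z * g z" for s g
  proof (cases "Im w = 0")
    case True
    then have "cnj w = w" by (simp add: complex_eq_iff)
    have "[:- w, 1:] ^ (2 * s) dvd ?N"
      using that(1) by (intro linear_power_dvdI[where g = g])
        (simp_all add: g poly_d \<open>cnj w = w\<close> power_mult power2_eq_square continuous_on_eq_continuous_at)
    then have "2 * s \<le> order w ?N"
      using nz by (simp add: order_divides)
    then show ?thesis
      using True by simp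
  next
    case False
    \<comment> \<open>The factor belonging to \<open>cnj w\<close> is absorbed into the continuous
      quotient.\<close>
    have "[:- w, 1:] ^ s dvd ?N"
    proof (rule linear_power_dvdI)
      show "poly ?N z = (z - w) ^ s * ((z - cnj w) ^ s * g z)" for z
        by (simp add: g poly_d power_mult_distrib mult.assoc)
      show "isCont (\<lambda>z. (z - cnj w) ^ s * g z) w"
        using that(1) by (intro continuous_intros) (simp add: continuous_on_eq_continuous_at)
    qed
    then show ?thesis
      using False nz by (simp add: order_divides)
  qed
  ultimately have dvd_iff: "slice_dvd A UNIV (stem_pow A (delta_stem A (areal A (Re w) + Im w *\<^sub>R J)) s)
      (normal_stem A (poly_stem a m)) \<longleftrightarrow> s \<le> ?\<mu>" for s
  proof -
    have eqs: "stem_pow A (delta_stem A (areal A (Re w) + Im w *\<^sub>R J)) s =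
          (\<lambda>z. complex_stem A (poly (d ^ s) z))"
        "normal_stem A (poly_stem a m) = (\<lambda>z. complex_stem A (poly ?N z))"
      using normal_stem_eq[OF adm] unfolding delta_stem_eq[OF J] stem_pow_complex_stem d_def
      by (auto simp: poly_power)
    have ds: "map_poly cnj (d ^ s) = d ^ s"
      by (simp add: map_poly_cnj_power d)
    show ?thesis
      unfolding eqs
    proof
      assume "slice_dvd A UNIV (\<lambda>z. complex_stem A (poly (d ^ s) z)) (\<lambda>z. complex_stem A (poly ?N z))"
      then obtain g where "continuous_on UNIV g" "\<And>z. poly ?N z = poly (d ^ s) z * g z"
        using slice_dvd_complex_stemD[OF ds map_poly_cnj_normal_poly] J by blast
      then show "s \<le> ?\<mu>"
        by fact
    next
      assume "s \<le> ?\<mu>"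
      then have "d ^ s dvd ?N"
        by fact
      then show "slice_dvd A UNIV (\<lambda>z. complex_stem A (poly (d ^ s) z)) (\<lambda>z. complex_stem A (poly ?N z))"
        using d by (intro slice_dvd_complex_stemI ds map_poly_cnj_normal_poly) simp
    qed
  qed
  \<comment> \<open>The admissible exponents form an initial segment, so its last element is the
    unique one in the definition.\<close>
  show ?thesis
    unfolding zero_multiplicity_def dvd_iff by (intro the_equality) auto
qed

text \<open>
  The form \<open>n\<close> on the span of \<open>F\<^sub>1(z)\<close> and \<open>F\<^sub>2(z)\<close> is anisotropic, hence definite, and it
  vanishes only at the finitely many roots of \<open>N(p)\<close>. Their complement in the plane is connected, so
  the form has the same sign throughout; on the real axis its trace is \<open>N(p)\<close>.
\<close>

lemma normal_poly_real_sign: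
  assumes adm: "admissible A UNIV (poly_stem a m)" and nz: "normal_poly A a m \<noteq> 0"
  shows "(\<forall>x::real. Re (poly (normal_poly A a m) x) \<ge> 0) \<or>
    (\<forall>x::real. Re (poly (normal_poly A a m) x) \<le> 0)"
proof -
  let ?N = "normal_poly A a m"
  define S where "S = UNIV - {z. poly ?N z = 0}"
  define h where "h z = real_part A (fst (poly_stem a m z) \<odot> aconj A (fst (poly_stem a m z))) +
    real_part A (snd (poly_stem a m z) \<odot> aconj A (snd (poly_stem a m z)))" for z
  have "connected S"
    unfolding S_def
    by (rule connected_open_delete_finite) (simp_all add: connected_UNIV poly_roots_finite[OF nz])
  moreover have "continuous_on S h"
    unfolding h_def poly_stem_def fst_conv snd_conv mult_conj_sum linear_sum[OF linear_real_part]
      linear_scale[OF linear_real_part]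
    by (intro continuous_intros)
  ultimately have conn: "connected (h ` S)"
    by (rule connected_continuous_image[rotated])
  have h_nz: "h z \<noteq> 0" if "z \<in> S" for z
  proof
    assume "h z = 0"
    then have "fst (poly_stem a m z) = 0" "snd (poly_stem a m z) = 0"
      using definite_on_normal_span adm unfolding admissible_def h_def by blast+
    then have "poly ?N z = 0"
      unfolding complex_part_normal_stem[symmetric]
      by (simp add: normal_stem_def stem_mult_def complex_part_def mult_simps
          linear_0[OF linear_real_part] complex_eq_iff)
    then show False
      using that by (simp add: S_def)
  qed
  have h_real: "h x = Re (poly ?N x)" for x :: real
    unfolding complex_part_normal_stem[symmetric]
    by (simp add: h_def complex_part_def normal_stem_def stem_mult_def stem_conj_def poly_stem_def
        mult_simps linear_0[OF linear_conj] linear_0[OF linear_real_part] flip: of_real_power)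
  show ?thesis
  proof (rule ccontr)
    assume "\<not> ?thesis"
    then obtain x y :: real where xy: "h x < 0" "h y > 0"
      unfolding h_real by (auto simp: not_le)
    then have "complex_of_real x \<in> S" "complex_of_real y \<in> S"
      unfolding h_real by (auto simp: S_def)
    then have "h x \<in> h ` S" "h y \<in> h ` S"
      by blast+
    then have "0 \<in> h ` S"
      using xy connectedD_interval[OF conn, of "h x" "h y" 0] by simp
    then show False
      using h_nz by force
  qed
qed

lemma even_order_normal_poly:
  assumes "admissible A UNIV (poly_stem a m)" and nz: "normal_poly A a m \<noteq> 0"
  shows "even (order (complex_of_real r) (normal_poly A a m))"
  using normal_poly_real_sign[OF assms]
proof
  assume "\<forall>x::real. Re (poly (normal_poly A a m) x) \<ge> 0"
  then show ?thesis
    by (intro even_order_real_root nz map_poly_cnj_normal_poly) simp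
next
  assume neg: "\<forall>x::real. Re (poly (normal_poly A a m) x) \<le> 0"
  have "map_poly cnj (- normal_poly A a m) = - normal_poly A a m"
    by (rule poly_eqI) (metis coeff_map_poly coeff_minus complex_cnj_minus complex_cnj_zero
        map_poly_cnj_normal_poly)
  then have "even (order (complex_of_real r) (- normal_poly A a m))"
    using neg nz by (intro even_order_real_root) simp_all
  then show ?thesis
    by simp
qed

section \<open>Spheres and the zeros of p and N(p)\<close>

lemma sphere_of_eq:
  assumes "J \<in> imaginary_units A"
  shows "sphere_of A (areal A \<alpha> + \<beta> *\<^sub>R J) = {areal A \<alpha> + \<beta> *\<^sub>R I |I. I \<in> imaginary_units A}"
proof (intro equalityI subsetI)
  fix y assume "y \<in> sphere_of A (areal A \<alpha> + \<beta> *\<^sub>R J)"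
  then obtain \<alpha>' \<beta>' J' I where *: "J' \<in> imaginary_units A" "I \<in> imaginary_units A"
      "areal A \<alpha> + \<beta> *\<^sub>R J = areal A \<alpha>' + \<beta>' *\<^sub>R J'" "y = areal A \<alpha>' + \<beta>' *\<^sub>R I"
    unfolding sphere_of_def by blast
  from assms *(1,3) show "y \<in> {areal A \<alpha> + \<beta> *\<^sub>R I |I. I \<in> imaginary_units A}"
  proof (cases rule: decomposition_cases)
    case 3
    then have "y = areal A \<alpha> + \<beta> *\<^sub>R (- I)" using *(4) by simp
    then show ?thesis using *(2) minus_imaginary_unit by blast
  qed (use * in auto)
next
  fix y assume "y \<in> {areal A \<alpha> + \<beta> *\<^sub>R I |I. I \<in> imaginary_units A}"
  then show "y \<in> sphere_of A (areal A \<alpha> + \<beta> *\<^sub>R J)"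
    using assms unfolding sphere_of_def by blast
qed

lemma complex_plane_eq_0:
  assumes "J \<in> imaginary_units A" "areal A r + s *\<^sub>R J = 0"
  shows "r = 0 \<and> s = 0"
proof -
  have "areal A r + s *\<^sub>R J = areal A 0 + 0 *\<^sub>R J"
    using assms(2) by (simp add: areal_simps)
  from assms(1,1) this show ?thesis
    by (cases rule: decomposition_cases) auto
qed

text \<open>Replacing (beta, J) by (- beta, - J) makes the imaginary part nonnegative, which leaves
  one \<open>w\<close> for each sphere.\<close>

lemma quadratic_cone_cases:
  assumes ex: "imaginary_units A \<noteq> {}" and x: "x \<in> quadratic_cone A"
  obtains w J where "Im w \<ge> 0" "J \<in> imaginary_units A" "x = areal A (Re w) + Im w *\<^sub>R J"
proof -
  obtain \<alpha> \<beta> J where J: "J \<in> imaginary_units A" and x: "x = areal A \<alpha> + \<beta> *\<^sub>R J"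
    using x unfolding slice_domain_UNIV[OF ex, symmetric] slice_domain_def by blast
  show thesis
  proof (cases "\<beta> \<ge> 0")
    case True
    then show ?thesis using that[of "Complex \<alpha> \<beta>" J] J x by simp
  next
    case False
    then show ?thesis
      using that[of "Complex \<alpha> (- \<beta>)" "- J"] minus_imaginary_unit[OF J] x by simp
  qed
qed

lemma quadratic_coneI:
  assumes "J \<in> imaginary_units A"
  shows "areal A \<alpha> + \<beta> *\<^sub>R J \<in> quadratic_cone A"
proof -
  have "areal A \<alpha> + \<beta> *\<^sub>R J \<in> slice_domain A UNIV"
    using assms unfolding slice_domain_def by blast
  then show ?thesis
    using assms slice_domain_UNIV by blast
qed

lemma poly_fun_eq:
  assumes "J \<in> imaginary_units A"
  shows "poly_fun A a m (areal A (Re w) + Im w *\<^sub>R J) =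
    fst (poly_stem a m w) + J \<odot> snd (poly_stem a m w)"
proof -
  have "areal A (Re w) + Im w *\<^sub>R J \<in> slice_domain A UNIV"
    using assms unfolding slice_domain_def by blast
  then show ?thesis
    using slice_poly_stem slice_eq[OF stem_function_poly_stem UNIV_I assms, where \<alpha> = "Re w" and \<beta> = "Im w"]
    by (metis complex.collapse)
qed

text \<open>The value lies in the complex plane of \<open>J\<close> and its coordinates do not
  depend on \<open>J\<close>, so N(p) vanishes on all of a sphere or nowhere on it.\<close>

lemma slice_normal_stem_eq_0_iff:
  assumes adm: "admissible A UNIV (poly_stem a m)" and J: "J \<in> imaginary_units A"
  shows "slice A (normal_stem A (poly_stem a m)) (areal A (Re w) + Im w *\<^sub>R J) = 0 \<longleftrightarrow>
    poly (normal_poly A a m) w = 0"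
proof -
  have "normal_stem A (poly_stem a m) = (\<lambda>z. complex_stem A (poly (normal_poly A a m) z))"
    using normal_stem_eq[OF adm] by blast
  then have "slice A (normal_stem A (poly_stem a m)) (areal A (Re w) + Im w *\<^sub>R J) =
      areal A (Re (poly (normal_poly A a m) w)) + Im (poly (normal_poly A a m) w) *\<^sub>R J"
    using slice_eq[OF stem_function_complex_stem[OF map_poly_cnj_normal_poly] UNIV_I J, where \<alpha> = "Re w" and \<beta> = "Im w"]
    by (simp add: complex_stem_def areal_mult)
  then show ?thesis
    using complex_plane_eq_0[OF J] by (auto simp: complex_eq_iff areal_simps)
qed

text \<open>The two components of the normal stem function vanish exactly when F1 and F2 have equal
  norms and are orthogonal, the condition for solving F1 + J F2 = 0.\<close>

lemma normal_poly_root_iff: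
  assumes adm: "admissible A UNIV (poly_stem a m)" and ex: "imaginary_units A \<noteq> {}"
  shows "poly (normal_poly A a m) w = 0 \<longleftrightarrow>
    (\<exists>J\<in>imaginary_units A. fst (poly_stem a m w) + J \<odot> snd (poly_stem a m w) = 0)"
proof -
  define x y where "x = fst (poly_stem a m w)" and "y = snd (poly_stem a m w)"
  have "span {x, y} \<subseteq> normal_cone A"
    using adm by (auto simp: admissible_def x_def y_def)
  then have mem: "x \<in> normal_cone A" "y \<in> normal_cone A"
    by (auto intro: span_base)
  have "poly (normal_poly A a m) w = 0 \<longleftrightarrow> normal_stem A (poly_stem a m) w = 0"
    using normal_stem_eq[OF adm UNIV_I, of w] complex_stem_eq_iff[of _ 0]
    by (simp add: complex_stem_def areal_simps zero_prod_def)
  also have "\<dots> \<longleftrightarrow> x \<odot> aconj A x = y \<odot> aconj A y \<and> x \<odot> aconj A y + y \<odot> aconj A x = 0"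
    by (simp add: normal_stem_def stem_mult_def stem_conj_def x_def y_def zero_prod_def)
  also have "\<dots> \<longleftrightarrow> (\<exists>J\<in>imaginary_units A. x + J \<odot> y = 0)"
    using imaginary_unit_of_isotropic_pair[OF mem _ _ ex] isotropic_pair_of_imaginary_unit[OF mem]
    by blast
  finally show ?thesis
    by (simp add: x_def y_def)
qed

end

section \<open>Zeros of polynomials\<close>

theorem theorem26:
  fixes A :: "'a::euclidean_space star_algebra" and a :: "nat \<Rightarrow> 'a" and m :: nat
  assumes "alternative_star_algebra A"
    and "imaginary_units A \<noteq> {}"
    and "m > 0" and "a m \<noteq> 0" and "a m \<in> normal_cone A"
    and "admissible A UNIV (poly_stem a m)"
  shows "let V = zero_set (quadratic_cone A) (poly_fun A a m);
             VN = zero_set (quadratic_cone A) (slice A (normal_stem A (poly_stem a m)))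
    in V \<noteq> {} \<and>
      (\<exists>(t::nat) x.
        (\<forall>k\<in>{1..t}. x k \<in> quadratic_cone A) \<and>
        inj_on (\<lambda>k. sphere_of A (x k)) {1..t} \<and>
        V \<subseteq> (\<Union>k\<in>{1..t}. sphere_of A (x k)) \<and>
        (\<Union>k\<in>{1..t}. sphere_of A (x k)) = VN \<and>
        (\<forall>k\<in>{1..t}. V \<inter> sphere_of A (x k) \<noteq> {}) \<and>
        (\<forall>y. (\<forall>k\<in>{1..t}. y k \<in> V \<inter> sphere_of A (x k)) \<longrightarrow>
          (\<Sum>k\<in>{1..t}. zero_multiplicity A UNIV (poly_stem a m) (y k)) = m))"
proof -
  interpret alternative_star_algebra A by fact
  note ex = assms(2) and adm = assms(6)
  define N where "N = normal_poly A a m"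
  define V where "V = zero_set (quadratic_cone A) (poly_fun A a m)"
  define VN where "VN = zero_set (quadratic_cone A) (slice A (normal_stem A (poly_stem a m)))"
  define Z where "Z = {z. poly N z = 0 \<and> Im z \<ge> 0}"
  define \<mu> where "\<mu> w = (if Im w = 0 then order w N div 2 else order w N)" for w
  \<comment> \<open>A nonzero element of the normal cone has nonzero norm, so the degree is exactly
    \<open>2 * m\<close>.\<close>
  have "coeff N (2 * m) \<noteq> 0"
    using assms(5)
  proof (cases rule: normal_cone_cases)
    case (2 r)
    then show ?thesis by (simp add: N_def coeff_normal_poly_top)
  qed (use assms(4) in simp)
  then have nz: "N \<noteq> 0" and "degree N = 2 * m"
    using degree_normal_poly_le[of A a m] le_degree[of N "2 * m"] by (auto simp: N_def)
  then have sum_\<mu>: "sum \<mu> Z = m"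
    using sum_half_orders[of N] even_order_normal_poly[OF adm] map_poly_cnj_normal_poly[of A a m]
    unfolding \<mu>_def Z_def by (simp add: N_def)
  have "finite Z"
    using poly_roots_finite[OF nz] by (simp add: Z_def)
  then obtain w where w: "bij_betw w {1..card Z} Z"
    using ex_bij_betw_nat_finite_1 by blast
  obtain J where J: "J \<in> imaginary_units A"
    using ex by blast
  define x where "x k = areal A (Re (w k)) + Im (w k) *\<^sub>R J" for k
  have wZ: "w k \<in> Z" if "k \<in> {1..card Z}" for k
    using w that by (auto simp: bij_betw_def)
  have sphere: "sphere_of A (x k) =
      {areal A (Re (w k)) + Im (w k) *\<^sub>R I |I. I \<in> imaginary_units A}" for k
    unfolding x_def by (rule sphere_of_eq[OF J])
  have inj: "inj_on (\<lambda>k. sphere_of A (x k)) {1..card Z}"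
  proof (rule inj_onI)
    fix k l assume kl: "k \<in> {1..card Z}" "l \<in> {1..card Z}" and "sphere_of A (x k) = sphere_of A (x l)"
    then obtain I where I: "I \<in> imaginary_units A"
        "areal A (Re (w k)) + Im (w k) *\<^sub>R J = areal A (Re (w l)) + Im (w l) *\<^sub>R I"
      using J unfolding sphere by blast
    \<comment> \<open>This excludes that \<open>w k\<close> and \<open>w l\<close> are distinct
      conjugates, which would span the same sphere.\<close>
    have "Im (w k) \<ge> 0" "Im (w l) \<ge> 0"
      using kl[THEN wZ] by (auto simp: Z_def)
    with J I have "w k = w l"
      by (cases rule: decomposition_cases) (auto simp: complex_eq_iff)
    then show "k = l"
      using inj_onD[OF bij_betw_imp_inj_on[OF w] _ kl] by blast
  qed
  have VN: "(\<Union>k\<in>{1..card Z}. sphere_of A (x k)) = VN"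
  proof (intro equalityI subsetI)
    fix v assume "v \<in> (\<Union>k\<in>{1..card Z}. sphere_of A (x k))"
    then obtain k I where "k \<in> {1..card Z}" "I \<in> imaginary_units A"
        "v = areal A (Re (w k)) + Im (w k) *\<^sub>R I"
      unfolding sphere by blast
    then show "v \<in> VN"
      using wZ[of k] slice_normal_stem_eq_0_iff[OF adm, of I "w k"] quadratic_coneI
      by (simp add: VN_def zero_set_def Z_def N_def)
  next
    fix v assume v: "v \<in> VN"
    then have "v \<in> quadratic_cone A"
      by (simp add: VN_def zero_set_def)
    then obtain u I where u: "Im u \<ge> 0" "I \<in> imaginary_units A" "v = areal A (Re u) + Im u *\<^sub>R I"
      by (rule quadratic_cone_cases[OF ex])
    then have "u \<in> Z"
      using v slice_normal_stem_eq_0_iff[OF adm, of I u] by (simp add: VN_def zero_set_def Z_def N_def)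
    then obtain k where "k \<in> {1..card Z}" "u = w k"
      using bij_betw_imp_surj_on[OF w] by blast
    then show "v \<in> (\<Union>k\<in>{1..card Z}. sphere_of A (x k))"
      unfolding sphere using u by blast
  qed
  have V_VN: "V \<subseteq> VN"
  proof
    fix v assume v: "v \<in> V"
    then have Q: "v \<in> quadratic_cone A"
      by (simp add: V_def zero_set_def)
    then obtain u I where u: "Im u \<ge> 0" "I \<in> imaginary_units A" "v = areal A (Re u) + Im u *\<^sub>R I"
      by (rule quadratic_cone_cases[OF ex])
    then have "fst (poly_stem a m u) + I \<odot>\<^bsub>A\<^esub> snd (poly_stem a m u) = 0"
      using v poly_fun_eq[OF u(2), of a m u] by (simp add: V_def zero_set_def)
    then have "poly (normal_poly A a m) u = 0"
      using normal_poly_root_iff[OF adm ex] u(2) by blast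
    then show "v \<in> VN"
      using Q slice_normal_stem_eq_0_iff[OF adm u(2)] by (simp add: VN_def zero_set_def u(3))
  qed
  have meets: "V \<inter> sphere_of A (x k) \<noteq> {}" if "k \<in> {1..card Z}" for k
  proof -
    have "poly (normal_poly A a m) (w k) = 0"
      using wZ[OF that] by (simp add: Z_def N_def)
    then obtain I where I: "I \<in> imaginary_units A"
        "fst (poly_stem a m (w k)) + I \<odot>\<^bsub>A\<^esub> snd (poly_stem a m (w k)) = 0"
      using normal_poly_root_iff[OF adm ex] by blast
    then have "areal A (Re (w k)) + Im (w k) *\<^sub>R I \<in> V"
      using quadratic_coneI poly_fun_eq[OF I(1)] by (simp add: V_def zero_set_def)
    then show ?thesis
      unfolding sphere using I(1) by blast
  qed
  \<comment> \<open>An empty sum could not equal the positive \<open>m\<close>, so there is a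
    sphere, and with it a zero of p.\<close>
  have "card Z \<noteq> 0"
    using sum_\<mu> \<open>m > 0\<close> \<open>finite Z\<close> by auto
  then have "1 \<in> {1..card Z}"
    by simp
  then have "V \<noteq> {}"
    using meets by blast
  moreover have "(\<Sum>k\<in>{1..card Z}. zero_multiplicity A UNIV (poly_stem a m) (y k)) = m"
    if y: "\<forall>k\<in>{1..card Z}. y k \<in> V \<inter> sphere_of A (x k)" for y
  proof -
    \<comment> \<open>The multiplicity depends on the root only, not on the imaginary unit of
      \<open>y k\<close>; hence any choice of zeros gives the same sum.\<close>
    have "zero_multiplicity A UNIV (poly_stem a m) (y k) = \<mu> (w k)" if "k \<in> {1..card Z}" for k
    proof -
      have "y k \<in> sphere_of A (x k)"
        using y that by blast
      then obtain I where I: "I \<in> imaginary_units A" "y k = areal A (Re (w k)) + Im (w k) *\<^sub>R I"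
        unfolding sphere by blast
      show ?thesis
        unfolding I(2) zero_multiplicity_eq[OF adm I(1) nz[unfolded N_def]] \<mu>_def N_def ..
    qed
    then have "(\<Sum>k\<in>{1..card Z}. zero_multiplicity A UNIV (poly_stem a m) (y k)) =
        (\<Sum>k\<in>{1..card Z}. \<mu> (w k))"
      by (intro sum.cong refl)
    also have "\<dots> = sum \<mu> Z"
      by (rule sum.reindex_bij_betw[OF w])
    finally show ?thesis
      using sum_\<mu> by simp
  qed
  moreover have "x k \<in> quadratic_cone A" for k
    unfolding x_def by (rule quadratic_coneI[OF J])
  ultimately show ?thesis
    unfolding Let_def V_def[symmetric] VN_def[symmetric]
    using inj VN V_VN meets by (intro conjI exI[of _ "card Z"] exI[of _ x] ballI allI impI) simp_all
qed

end
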